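(* Let $m\ge1$ and $\delta_1,\dots,\delta_m\ge0$, and suppose that $a_1=\delta_1N,\dots,a_m=\delta_mN$. For $z\in\mathbb{C}\setminus\{0\}$ let $\xi_m(z)$ be the largest real root of the algebraic equation in $x$ $$\prod_{k=1}^m(\delta_k-\delta_m+|z|^2x)-|z|^2=0.$$ Then for every complex $z\ne0$ the limiting eigenvalue density satisfies $$R_1(z):=\lim_{N\to\infty}N^{m-1}R_{N,1}(N^{m/2}z)=\frac1{\pi|z|^2}\,\frac1{\sum_{k=1}^m\frac1{\delta_k-\delta_m+|z|^2\xi_m(z)}}\;\chi_{\{u:\sqrt{\delta_1\cdots\delta_m}<|u|<\sqrt{(1+\delta_1)\cdots(1+\delta_m)}\}}(z).$$
   Context: $R_{N,n}$ is the $n$-point eigenvalue correlation function of the product $X_mX_{m-1}\cdots X_1$ of independent $N\times N$ matrices, $X_k$ having density proportional to $(\det X_k^*X_k)^{a_k}e^{-\mathrm{tr}(X_k^*X_k)}$. It is given explicitly by $R_{N,n}(z_1,\dots,z_n)=\det\big(K_N(z_j,z_k)\big)_{1\le j,k\le n}$, so $R_{N,1}(z)=K_N(z,z)$, where $$K_N(z,z')=\sqrt{w_m(z)w_m(\overline{z'})}\sum_{l=0}^{N-1}\prod_{k=1}^m\frac{\Gamma(a_k+1)}{\Gamma(a_k+l+1)}(z\overline{z'})^l,$$ $$w_m(z)=|z|^{2a_m}\frac{2^{m-1}}{\pi}\prod_{k=1}^m\frac1{\Gamma(a_k+1)}\int_{\mathbb{R}_+^{m-1}}\exp\Big\{-\sum_{k=1}^{m-1}r_k^2-\frac{|z|^2}{r_1^2\cdots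 r_{m-1}^2}\Big\}\prod_{k=1}^{m-1}r_k^{2(a_k-a_m)-1}\,d^{m-1}r$$ (for $m=1$ the integral is read as $e^{-|z|^2}$). Convention for $\chi$: if $r_{\mathrm{in}}>0$, $\chi_{\{u:r_{\mathrm{in}}<|u|<r_{\mathrm{out}}\}}(z)$ equals $1$ if $r_{\mathrm{in}}<|z|<r_{\mathrm{out}}$, equals $1/2$ if $|z|=r_{\mathrm{in}}$ or $|z|=r_{\mathrm{out}}$, and $0$ otherwise. If $r_{\mathrm{in}}=0$ it equals $1$ for $|z|<r_{\mathrm{out}}$, $1/2$ for $|z|=r_{\mathrm{out}}$, and $0$ otherwise. *)

theory Defs
  imports "HOL-Analysis.Analysis"
begin

text \<open>
  The integral over \<open>\<real>\<^sub>+\<^sup>m\<^sup>-\<^sup>1\<close> is taken with respect to the product Lebesgue measure on functions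
  with index set \<open>{1..<m}\<close>. For \<open>m = 1\<close> that measure is the unit mass on a one-point space, so
  that the integral is \<open>exp (- |z|^2)\<close> (lemma \<open>weight_1\<close> below). The definition is
  meant for \<open>z \<noteq> 0\<close>, where the integral converges; note that \<open>0 powr 0 = 0\<close>.
\<close>

definition weight :: "nat \<Rightarrow> (nat \<Rightarrow> real) \<Rightarrow> complex \<Rightarrow> real" where
  "weight m a z =
     cmod z powr (2 * a m) * (2 ^ (m - 1) / pi) * (\<Prod>k=1..m. 1 / Gamma (a k + 1)) *
     (LINT r : (PiE {1..<m} (\<lambda>_. {0<..})) | (PiM {1..<m} (\<lambda>_. lborel)).
        exp (- (\<Sum>k\<in>{1..<m}. (r k)\<^sup>2) - (cmod z)\<^sup>2 / (\<Prod>k\<in>{1..<m}. (r k)\<^sup>2)) *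
        (\<Prod>k\<in>{1..<m}. r k powr (2 * (a k - a m) - 1)))"

definition kernel :: "nat \<Rightarrow> (nat \<Rightarrow> real) \<Rightarrow> nat \<Rightarrow> complex \<Rightarrow> complex \<Rightarrow> complex" where
  "kernel m a N z z' =
     of_real (sqrt (weight m a z * weight m a (cnj z'))) *
     (\<Sum>l<N. of_real (\<Prod>k=1..m. Gamma (a k + 1) / Gamma (a k + real l + 1)) * (z * cnj z') ^ l)"

text \<open>
  The \<open>n\<close>-point eigenvalue correlation function \<open>R\<^sub>N\<^sub>,\<^sub>n\<close> of \<open>X\<^sub>m \<cdots> X\<^sub>1\<close>, with \<open>n = CARD('n)\<close>. Here
  \<open>X\<^sub>1, \<dots>, X\<^sub>m\<close> are independent \<open>N \<times> N\<close> matrices and \<open>X\<^sub>k\<close> has density proportional to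
  \<open>(det X\<^sub>k\<^sup>* X\<^sub>k) powr (a k) * exp (- tr X\<^sub>k\<^sup>* X\<^sub>k)\<close>. Correlation functions are determined by the
  matrix model only up to null sets; pointwise statements refer to the following explicit version.
\<close>

definition correlation :: "nat \<Rightarrow> (nat \<Rightarrow> real) \<Rightarrow> nat \<Rightarrow> complex ^ 'n \<Rightarrow> complex" where
  "correlation m a N z = det (\<chi> j k. kernel m a N (z $ j) (z $ k))"

text \<open>
  The largest root exists for \<open>z \<noteq> 0\<close>, \<open>m \<ge> 1\<close>: the left-hand side is a nonconstant polynomial
  in \<open>x\<close>, negative at the largest zero of the product and tending to infinity.
\<close>

definition largest_root :: "nat \<Rightarrow> (nat \<Rightarrow> real) \<Rightarrow> complex \<Rightarrow> real" where
  "largest_root m \<delta> z =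
     (GREATEST x. (\<Prod>k=1..m. \<delta> k - \<delta> m + (cmod z)\<^sup>2 * x) - (cmod z)\<^sup>2 = 0)"

text \<open>
  Boundary circles get the value \<open>1/2\<close>. For inner radius \<open>0\<close> the origin counts as an interior point.
\<close>

definition annulus_indicator :: "real \<Rightarrow> real \<Rightarrow> complex \<Rightarrow> real" where
  "annulus_indicator r_in r_out z =
     (if r_in > 0 then
        (if r_in < cmod z \<and> cmod z < r_out then 1
         else if cmod z = r_in \<or> cmod z = r_out then 1 / 2 else 0)
      else
        (if cmod z < r_out then 1 else if cmod z = r_out then 1 / 2 else 0))"

lemma weight_1:
  "weight 1 a z = cmod z powr (2 * a 1) / (pi * Gamma (a 1 + 1)) * exp (- (cmod z)\<^sup>2)"
  by (simp add: weight_def set_lebesgue_integral_def PiM_empty lebesgue_integral_count_space_finite)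

lemma correlation_1:
  "correlation m a N (vec z :: complex ^ 1) = kernel m a N z z"
  by (simp add: correlation_def det_1)

end

theory Submission
  imports Defs "HOL-Probability.Probability" "HOL-Real_Asymp.Real_Asymp"
begin

text \<open>
  Let \<open>s = |z|\<^sup>2\<close> and let \<open>t\<close> be the solution of \<open>\<Prod>k. (\<delta> k + t) = s\<close> with all factors positive, so that
  \<open>\<delta> k + t = \<delta> k - \<delta> m + s * \<xi>\<close> for the largest root \<open>\<xi>\<close>. The \<open>l\<close>-th summand of \<open>R\<^sub>N\<^sub>,\<^sub>1\<close> is, up to a
  factor, the density of a product of independent gamma variables with shapes \<open>\<delta> k * N + l + 1\<close>, which
  is concentrated where \<open>l\<close> is near \<open>t * N\<close>. The substitution \<open>r k = sqrt (c k) * exp (x k / (2 * sqrt N))\<close>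
  with \<open>c k = (\<delta> k + t) * N\<close> turns the integral in the weight into an integral \<open>P N\<close> of functions
  \<open>exp (- c k * (exp v - 1 - v))\<close>, \<open>v = x k / sqrt N\<close>, and the quotients of Gamma values into the
  reciprocals of one-dimensional integrals of the same kind with an additional factor
  \<open>exp (\<beta> * v)\<close>, \<open>\<beta> = l + 1 - t * N\<close>. No Stirling formula is needed: dominated convergence
  makes all these integrals Gaussian. With \<open>B = \<Sum>k. 1 / (\<delta> k + t)\<close>, the limit of \<open>P N\<close>
  contributes \<open>1 / sqrt (2 * pi * B)\<close> and the sum over \<open>l\<close> contributes \<open>sqrt (2 * pi / B)\<close>,
  one half of it, or nothing, according to whether \<open>t\<close> is inside, on the boundary of, or outside \<open>[0, 1]\<close>.
\<close>

section \<open>Exponential change of variables on positive orthants\<close>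

text \<open>The substitution rule on a compact interval is exhausted: the symmetric intervals in
  \<open>x\<close> increase to the line, their images increase to the positive half-line, and
  monotone convergence passes to the limit on both sides.\<close>

lemma nn_integral_exp_substitution:
  fixes f :: "real \<Rightarrow> ennreal"
  assumes [measurable]: "f \<in> borel_measurable borel" and "c > 0" "q > 0"
  shows "(\<integral>\<^sup>+y. f y * indicator {0<..} y \<partial>lborel) =
         (\<integral>\<^sup>+x. f (c * exp (q * x)) * ennreal (c * q * exp (q * x)) \<partial>lborel)"
proof -
  let ?g = "\<lambda>x. c * exp (q * x)"
  let ?A = "\<lambda>n::nat. {?g (- real (Suc n)) .. ?g (real (Suc n))}"
  let ?B = "\<lambda>n::nat. {- real (Suc n) .. real (Suc n)}"
  have eq: "(\<integral>\<^sup>+y. f y * indicator (?A n) y \<partial>lborel) =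
      (\<integral>\<^sup>+x. f (?g x) * ennreal (c * q * exp (q * x)) * indicator (?B n) x \<partial>lborel)" for n
    using assms
    by (intro nn_integral_substitution_aux)
       (auto intro!: derivative_eq_intros continuous_intros)
  have mono: "?A n \<subseteq> ?A n'" if "n \<le> n'" for n n'
    using that assms by (auto intro: order_trans)
  have lim1: "(\<lambda>n. \<integral>\<^sup>+y. f y * indicator (?A n) y \<partial>lborel) \<longlonglongrightarrow>
      (\<integral>\<^sup>+y. f y * indicator {0<..} y \<partial>lborel)"
  proof (rule nn_integral_LIMSEQ)
    show "incseq (\<lambda>n y. f y * indicator (?A n) y)"
      unfolding incseq_def le_fun_def
      by (intro allI impI mult_left_mono indicator_leI) (erule subsetD[OF mono], assumption, simp)
    fix y :: real
    show "(\<lambda>n. f y * indicator (?A n) y) \<longlonglongrightarrow> f y * indicator {0<..} y"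
    proof (cases "y > 0")
      case True
      have "eventually (\<lambda>n. real (Suc n) > \<bar>ln (y / c) / q\<bar>) sequentially"
        by real_asymp
      then have "eventually (\<lambda>n. y \<in> ?A n) sequentially"
      proof eventually_elim
        case (elim n)
        then have "ln (y / c) \<le> q * real (Suc n)" "- (q * real (Suc n)) \<le> ln (y / c)"
          using assms by (auto simp: abs_if field_simps split: if_splits)
        then have "y / c \<le> exp (q * real (Suc n))" "exp (- (q * real (Suc n))) \<le> y / c"
          using True assms by (metis divide_pos_pos exp_le_cancel_iff exp_ln)+
        then show ?case using assms by (simp add: field_simps)
      qed
      then show ?thesis
        using True by (intro tendsto_eventually) (auto elim: eventually_mono)
    next
      case False
      then have "y < ?g (- real (Suc n))" for n
        using assms by (intro order.strict_trans1[of y 0]) auto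
      then have "y \<notin> ?A n" for n
        by (simp add: not_le)
      then have "(\<lambda>n. f y * indicator (?A n) y) = (\<lambda>n. 0)"
        by (simp only: indicator_simps mult_zero_right not_False_eq_True)
      then show ?thesis using False by (simp only: indicator_simps) simp
    qed
  qed simp
  have lim2: "(\<lambda>n. \<integral>\<^sup>+x. f (?g x) * ennreal (c * q * exp (q * x)) * indicator (?B n) x \<partial>lborel) \<longlonglongrightarrow>
      (\<integral>\<^sup>+x. f (?g x) * ennreal (c * q * exp (q * x)) \<partial>lborel)"
  proof (rule nn_integral_LIMSEQ)
    show "incseq (\<lambda>n x. f (?g x) * ennreal (c * q * exp (q * x)) * indicator (?B n) x)"
      unfolding incseq_def le_fun_def
      by (intro allI impI mult_left_mono indicator_leI) auto
    fix x :: real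
    have "eventually (\<lambda>n. real (Suc n) > \<bar>x\<bar>) sequentially"
      by real_asymp
    then show "(\<lambda>n. f (?g x) * ennreal (c * q * exp (q * x)) * indicator (?B n) x) \<longlonglongrightarrow>
        f (?g x) * ennreal (c * q * exp (q * x))"
      by (intro tendsto_eventually, elim eventually_mono) (simp add: indicator_def abs_less_iff)
  qed simp
  show ?thesis
    using LIMSEQ_unique[OF lim1[unfolded eq] lim2] .
qed

text \<open>Induction on the index set by Tonelli, with the one-dimensional substitution in the new
  coordinate. The function is generalized because the induction hypothesis is applied to its
  sections with that coordinate fixed.\<close>

lemma nn_integral_PiM_exp_substitution:
  fixes f :: "('i \<Rightarrow> real) \<Rightarrow> ennreal" and c :: "'i \<Rightarrow> real"
  assumes "finite I" and "\<And>i. i \<in> I \<Longrightarrow> c i > 0" and "q > 0"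
    and "f \<in> borel_measurable (PiM I (\<lambda>_. lborel))"
  shows "(\<integral>\<^sup>+r. f r * indicator (PiE I (\<lambda>_. {0<..})) r \<partial>PiM I (\<lambda>_. lborel)) =
         (\<integral>\<^sup>+x. f (\<lambda>i\<in>I. c i * exp (q * x i)) * (\<Prod>i\<in>I. ennreal (c i * q * exp (q * x i)))
            \<partial>PiM I (\<lambda>_. lborel))"
  using assms
proof (induction I arbitrary: f)
  case empty
  then show ?case by (simp add: PiM_empty nn_integral_count_space_finite)
next
  case (insert i I)
  interpret product_sigma_finite "\<lambda>_::'i. lborel :: real measure" by standard
  note [measurable] = insert.prems(3)
  have c: "c i > 0" using insert.prems by auto
  have [measurable]: "(\<lambda>(x, y). f (x(i := y))) \<in> borel_measurable (PiM I (\<lambda>_. lborel) \<Otimes>\<^sub>M lborel)"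
    using measurable_compose[OF measurable_add_dim[of i I "\<lambda>_. lborel :: real measure"] insert.prems(3)]
    by (simp add: case_prod_unfold)
  have [measurable]: "PiE I (\<lambda>_. {0<..}) \<in> sets (PiM I (\<lambda>_. lborel :: real measure))"
    "PiE (insert i I) (\<lambda>_. {0<..}) \<in> sets (PiM (insert i I) (\<lambda>_. lborel :: real measure))"
    using insert.hyps by (auto intro!: sets_PiM_I_finite)
  have sec: "(\<lambda>x. f (x(i := y))) \<in> borel_measurable (PiM I (\<lambda>_. lborel))" for y
    by measurable
  have "(\<lambda>x. \<lambda>j\<in>insert i I. c j * exp (q * x j)) \<in>
      measurable (PiM (insert i I) (\<lambda>_. lborel)) (PiM (insert i I) (\<lambda>_. lborel))"
    by (intro measurable_restrict) measurable
  then have m: "(\<lambda>x. f (\<lambda>j\<in>insert i I. c j * exp (q * x j))) \<in> borel_measurable (PiM (insert i I) (\<lambda>_. lborel))"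
    using insert.prems(3) by (rule measurable_compose)
  let ?J = "\<lambda>x. (\<Prod>j\<in>I. ennreal (c j * q * exp (q * x j)))"
  have "(\<integral>\<^sup>+r. f r * indicator (PiE (insert i I) (\<lambda>_. {0<..})) r \<partial>PiM (insert i I) (\<lambda>_. lborel)) =
     (\<integral>\<^sup>+y. \<integral>\<^sup>+x. f (x(i := y)) * indicator (PiE (insert i I) (\<lambda>_. {0<..})) (x(i := y))
        \<partial>PiM I (\<lambda>_. lborel) \<partial>lborel)"
    using insert.hyps by (subst product_nn_integral_insert_rev) auto
  also have "\<dots> = (\<integral>\<^sup>+y. (\<integral>\<^sup>+x. f (x(i := y)) * indicator (PiE I (\<lambda>_. {0<..})) x
        \<partial>PiM I (\<lambda>_. lborel)) * indicator {0<..} y \<partial>lborel)"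
  proof (intro nn_integral_cong, subst nn_integral_multc[symmetric])
    fix y :: real
    show "(\<integral>\<^sup>+x. f (x(i := y)) * indicator (PiE (insert i I) (\<lambda>_. {0<..})) (x(i := y))
        \<partial>PiM I (\<lambda>_. lborel)) = (\<integral>\<^sup>+x. f (x(i := y)) * indicator (PiE I (\<lambda>_. {0<..})) x * indicator {0<..} y
        \<partial>PiM I (\<lambda>_. lborel))"
    proof (intro nn_integral_cong)
      fix x assume "x \<in> space (PiM I (\<lambda>_. lborel :: real measure))"
      then have "x \<in> extensional I" by (simp add: space_PiM PiE_def)
      then have "x(i := y) \<in> PiE (insert i I) (\<lambda>_. {0<..}) \<longleftrightarrow> x \<in> PiE I (\<lambda>_. {0<..}) \<and> y > 0"
        using insert.hyps(2) by (auto simp: PiE_def Pi_iff extensional_def)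
      then show "f (x(i := y)) * indicator (PiE (insert i I) (\<lambda>_. {0<..})) (x(i := y)) =
          f (x(i := y)) * indicator (PiE I (\<lambda>_. {0<..})) x * indicator {0<..} y"
        by (auto simp: indicator_def)
    qed
  qed (use sec in measurable)
  also have "\<dots> = (\<integral>\<^sup>+y. (\<integral>\<^sup>+x. f ((\<lambda>j\<in>I. c j * exp (q * x j))(i := y)) * ?J x
        \<partial>PiM I (\<lambda>_. lborel)) * indicator {0<..} y \<partial>lborel)"
    using insert.prems sec by (subst insert.IH) auto
  also have "\<dots> = (\<integral>\<^sup>+y. (\<integral>\<^sup>+x. f ((\<lambda>j\<in>I. c j * exp (q * x j))(i := c i * exp (q * y))) * ?J x
        \<partial>PiM I (\<lambda>_. lborel)) * ennreal (c i * q * exp (q * y)) \<partial>lborel)"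
  proof (rule nn_integral_exp_substitution)
    interpret I: finite_product_sigma_finite "\<lambda>_. lborel :: real measure" I
      by standard (use insert.hyps in auto)
    have "(\<lambda>x. \<lambda>j\<in>I. c j * exp (q * x j)) \<in>
      measurable (PiM I (\<lambda>_. lborel)) (PiM I (\<lambda>_. lborel))"
      by (intro measurable_restrict) measurable
    then have "(\<lambda>(y, x). (\<lambda>j\<in>I. c j * exp (q * x j), y)) \<in>
        measurable (borel \<Otimes>\<^sub>M PiM I (\<lambda>_. lborel)) (PiM I (\<lambda>_. lborel) \<Otimes>\<^sub>M lborel)"
      by measurable
    from measurable_compose[OF measurable_compose[OF this measurable_add_dim[of i I "\<lambda>_. lborel :: real measure"]] insert.prems(3)]
    have [measurable]: "(\<lambda>(y, x). f ((\<lambda>j\<in>I. c j * exp (q * x j))(i := y))) \<in>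
        borel_measurable (borel \<Otimes>\<^sub>M PiM I (\<lambda>_. lborel))"
      by (simp only: case_prod_unfold prod.sel)
    show "(\<lambda>y. \<integral>\<^sup>+x. f ((\<lambda>j\<in>I. c j * exp (q * x j))(i := y)) * ?J x
        \<partial>PiM I (\<lambda>_. lborel)) \<in> borel_measurable borel"
      by measurable
  qed (use c insert.prems in auto)
  also have "\<dots> = (\<integral>\<^sup>+y. \<integral>\<^sup>+x. f (\<lambda>j\<in>insert i I. c j * exp (q * (x(i := y)) j)) *
       (\<Prod>j\<in>insert i I. ennreal (c j * q * exp (q * (x(i := y)) j))) \<partial>PiM I (\<lambda>_. lborel) \<partial>lborel)"
  proof (intro nn_integral_cong, subst nn_integral_multc[symmetric])
    fix y :: real
    have "(\<lambda>x. \<lambda>j\<in>I. c j * exp (q * x j)) \<in>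
      measurable (PiM I (\<lambda>_. lborel)) (PiM I (\<lambda>_. lborel))"
      by (intro measurable_restrict) measurable
    from measurable_compose[OF this sec]
    show "(\<lambda>x. f ((\<lambda>j\<in>I. c j * exp (q * x j))(i := c i * exp (q * y))) * ?J x)
        \<in> borel_measurable (PiM I (\<lambda>_. lborel))"
      by measurable
    have *: "(\<lambda>j\<in>I. c j * exp (q * x j))(i := c i * exp (q * y)) =
        (\<lambda>j\<in>insert i I. c j * exp (q * (x(i := y)) j))" for x
      using insert.hyps(2) by (auto simp: fun_eq_iff)
    have **: "(\<Prod>j\<in>insert i I. ennreal (c j * q * exp (q * (x(i := y)) j))) =
        ?J x * ennreal (c i * q * exp (q * y))" for x
    proof -
      have "?J (x(i := y)) = ?J x"
        using insert.hyps(2) by (intro prod.cong) auto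
      then show ?thesis using insert.hyps by (simp add: mult.commute)
    qed
    show "(\<integral>\<^sup>+x. f ((\<lambda>j\<in>I. c j * exp (q * x j))(i := c i * exp (q * y))) * ?J x *
          ennreal (c i * q * exp (q * y)) \<partial>PiM I (\<lambda>_. lborel)) =
        (\<integral>\<^sup>+x. f (\<lambda>j\<in>insert i I. c j * exp (q * (x(i := y)) j)) *
          (\<Prod>j\<in>insert i I. ennreal (c j * q * exp (q * (x(i := y)) j))) \<partial>PiM I (\<lambda>_. lborel))"
      unfolding * ** by (simp add: mult.assoc)
  qed
  also have "\<dots> = (\<integral>\<^sup>+x. f (\<lambda>j\<in>insert i I. c j * exp (q * x j)) *
       (\<Prod>j\<in>insert i I. ennreal (c j * q * exp (q * x j))) \<partial>PiM (insert i I) (\<lambda>_. lborel))"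
    using insert.hyps m by (subst product_nn_integral_insert_rev) auto
  finally show ?case .
qed

section \<open>The tilted exponential: domination, Gaussian limit and Gamma integral\<close>

text \<open>
  \<open>tilt \<alpha> N \<beta>\<close> is, up to a constant, the density of \<open>sqrt N * ln (Y / (\<alpha> * N))\<close> for a gamma variable
  \<open>Y\<close> with shape \<open>\<alpha> * N + \<beta>\<close>. It converges to \<open>exp (y * x - \<alpha> * x\<^sup>2 / 2)\<close> if \<open>\<beta>\<close> grows like \<open>y * sqrt N\<close>.
\<close>

definition tilt :: "real \<Rightarrow> nat \<Rightarrow> real \<Rightarrow> real \<Rightarrow> real" where
  "tilt \<alpha> N \<beta> x =
     exp (\<beta> * (x / sqrt N) - \<alpha> * N * (exp (x / sqrt N) - 1 - x / sqrt N))"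

definition tilt_mass :: "real \<Rightarrow> nat \<Rightarrow> real \<Rightarrow> real" where
  "tilt_mass \<alpha> N \<beta> = (\<integral>x. tilt \<alpha> N \<beta> x \<partial>lborel)"

lemma tilt_pos: "tilt \<alpha> N \<beta> x > 0"
  by (simp add: tilt_def)

lemma tilt_measurable [measurable]: "tilt \<alpha> N \<beta> \<in> borel_measurable borel"
  unfolding tilt_def by measurable

text \<open>Deleting finitely many terms does not affect the limit. The form fits the bounds below,
  which hold only once \<open>N\<close> is large.\<close>

lemma integral_dominated_convergence_eventually:
  fixes f :: "'a \<Rightarrow> real" and s :: "nat \<Rightarrow> 'a \<Rightarrow> real"
  assumes "f \<in> borel_measurable M" "\<And>n. s n \<in> borel_measurable M" "integrable M w"
    and lim: "AE x in M. (\<lambda>n. s n x) \<longlonglongrightarrow> f x"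
    and bound: "eventually (\<lambda>n. \<forall>x\<in>space M. \<bar>s n x\<bar> \<le> w x) sequentially"
  shows "(\<lambda>n. integral\<^sup>L M (s n)) \<longlonglongrightarrow> integral\<^sup>L M f"
proof -
  obtain n0 where n0: "\<And>n x. n \<ge> n0 \<Longrightarrow> x \<in> space M \<Longrightarrow> \<bar>s n x\<bar> \<le> w x"
    using bound by (auto simp: eventually_sequentially)
  have "(\<lambda>n. integral\<^sup>L M (s (n + n0))) \<longlonglongrightarrow> integral\<^sup>L M f"
  proof (rule integral_dominated_convergence[where w = w])
    show "AE x in M. (\<lambda>n. s (n + n0) x) \<longlonglongrightarrow> f x"
      using lim by eventually_elim (rule LIMSEQ_ignore_initial_segment)
  qed (use assms n0 in auto)
  then show ?thesis by (rule LIMSEQ_offset)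
qed

text \<open>The common majorant of the dominated convergence arguments; it lies below the sum of an
  exponential density and its reflection.\<close>

lemma integrable_exp_minus_abs: "integrable lborel (\<lambda>x::real. exp (- \<bar>x\<bar>))"
proof -
  have "(\<integral>\<^sup>+x. ennreal (exp (- \<bar>x\<bar>)) \<partial>lborel) \<le>
      (\<integral>\<^sup>+x. ennreal (exponential_density 1 x) + ennreal (exponential_density 1 (- x)) \<partial>lborel)"
    by (intro nn_integral_mono) (auto simp: exponential_density_def abs_if)
  also have "\<dots> = (\<integral>\<^sup>+x. ennreal (exponential_density 1 x) \<partial>lborel) +
      (\<integral>\<^sup>+x. ennreal (exponential_density 1 (- x)) \<partial>lborel)"
    by (intro nn_integral_add) auto
  also have "(\<integral>\<^sup>+x. ennreal (exponential_density 1 (- x)) \<partial>lborel) =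
      (\<integral>\<^sup>+x. ennreal (exponential_density 1 x) \<partial>lborel)"
    by (subst nn_integral_real_affine[where c = "-1" and t = 0]) auto
  also have "(\<integral>\<^sup>+x. ennreal (exponential_density 1 x) \<partial>lborel) = 1"
    using prob_space.emeasure_space_1[OF prob_space_exponential_density[of 1]]
    by (simp add: emeasure_density)
  finally show ?thesis
    by (intro integrableI_nonneg) (auto simp: less_top[symmetric] top_unique)
qed

text \<open>By convexity \<open>exp\<close> lies above its tangents at \<open>u\<close> and at
  \<open>- u\<close>; the first is used for \<open>v \<ge> 0\<close>, the second for
  \<open>v < 0\<close>. After subtracting \<open>1 + v\<close> the remaining slope has absolute
  value at least \<open>u / 2\<close>. The free parameter \<open>u\<close> will shrink like
  \<open>1 / sqrt N\<close>.\<close>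

lemma exp_minus_tangent_ge:
  fixes u v :: real
  assumes "0 \<le> u" "u \<le> 1"
  shows "exp v - 1 - v \<ge> u / 2 * \<bar>v\<bar> - u\<^sup>2"
proof (cases "v \<ge> 0")
  case True
  have "exp u * (1 + (v - u)) \<le> exp u * exp (v - u)"
    by (intro mult_left_mono exp_ge_add_one_self) auto
  then have "exp v \<ge> exp u * (1 + v - u)"
    by (simp add: exp_diff algebra_simps)
  moreover have "exp u * v \<ge> (1 + u) * v" "exp u * (1 - u) \<ge> (1 + u) * (1 - u)"
    using True assms by (intro mult_right_mono exp_ge_add_one_self; simp)+
  moreover have "u / 2 * v \<le> u * v" using True assms by (intro mult_right_mono) auto
  ultimately show ?thesis
    using True by (simp add: algebra_simps power2_eq_square)
next
  case False
  have "exp (- u) * (1 + (v + u)) \<le> exp (- u) * exp (v + u)"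
    by (intro mult_left_mono exp_ge_add_one_self) auto
  moreover have "exp (- u) * exp (v + u) = exp v"
    by (simp flip: exp_add)
  ultimately have 1: "exp v \<ge> exp (- u) * (1 + v + u)"
    by (simp add: add.assoc)
  have 2: "(1 - u) * (1 + u) \<le> exp (- u) * (1 + u)"
    using exp_ge_add_one_self[of "- u"] assms by (intro mult_right_mono) auto
  have "exp (- u) * (1 + u) \<le> 1"
    using exp_ge_add_one_self[of u] by (simp add: exp_minus field_simps)
  moreover have "1 \<le> (1 - u / 2) * (1 + u)"
    using assms mult_left_mono[of u 1 u] by (simp add: algebra_simps)
  ultimately have "exp (- u) * (1 + u) \<le> (1 - u / 2) * (1 + u)"
    by linarith
  then have "exp (- u) \<le> 1 - u / 2"
    using assms by (simp add: mult_le_cancel_right)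
  then have "exp (- u) * v \<ge> (1 - u / 2) * v"
    using False by (intro mult_right_mono_neg) auto
  then show ?thesis
    using 1 2 False by (simp add: algebra_simps power2_eq_square)
qed

text \<open>For negative \<open>v\<close> the claim is multiplied by
  \<open>exp (- v) \<ge> 1 - v\<close>, since (1 + v + v^2)(1 - v) = 1 - v^3 is at least 1.\<close>

lemma exp_minus_tangent_le:
  fixes v :: real
  assumes "\<bar>v\<bar> \<le> 1"
  shows "exp v - 1 - v \<le> v\<^sup>2"
proof (cases "v \<ge> 0")
  case True
  then show ?thesis using exp_bound[of v] assms by simp
next
  case False
  have "1 - v ^ 3 \<ge> 1"
    using False by (simp add: power_less_zero_eq less_imp_le)
  then have "(1 + v + v\<^sup>2) * (1 - v) \<ge> 1"
    by (simp add: algebra_simps power2_eq_square power3_eq_cube)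
  moreover have "1 + v + v\<^sup>2 \<ge> 0"
    using assms False by (auto simp: abs_if)
  then have "(1 + v + v\<^sup>2) * (1 - v) \<le> (1 + v + v\<^sup>2) * exp (- v)"
    using exp_ge_add_one_self[of "- v"] by (intro mult_left_mono) auto
  ultimately have "1 \<le> (1 + v + v\<^sup>2) * exp (- v)" by linarith
  then show ?thesis by (simp add: exp_minus field_simps)
qed

text \<open>The tangent bound is used with \<open>u = K / sqrt N\<close>, which is at most 1 once
  \<open>N\<close> is at least K^2. The choice of \<open>K\<close> turns its linear part into
  \<open>(Y + 1) * \<bar>x\<bar>\<close>: the share \<open>Y * \<bar>x\<bar>\<close> absorbs the
  term with \<open>\<beta>\<close>, the rest is the decay, and the quadratic loss is the constant
  \<open>\<alpha>\<close> K^2, independent of \<open>N\<close>, \<open>\<beta>\<close> and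
  \<open>x\<close>.\<close>

lemma tilt_le_exp_minus_abs:
  assumes "\<alpha> > 0" "Y \<ge> 0"
  obtains C where "C > 0"
    "eventually (\<lambda>N. \<forall>\<beta> x. \<bar>\<beta>\<bar> \<le> Y * sqrt (real N) \<longrightarrow> tilt \<alpha> N \<beta> x \<le> C * exp (- \<bar>x\<bar>)) sequentially"
proof
  define K where "K = 2 * (Y + 1) / \<alpha>"
  have "K > 0" using assms by (auto simp: K_def)
  show "exp (\<alpha> * K\<^sup>2) > 0" by simp
  have "eventually (\<lambda>N. real N \<ge> max 1 (K\<^sup>2)) sequentially" by real_asymp
  then show "eventually (\<lambda>N. \<forall>\<beta> x. \<bar>\<beta>\<bar> \<le> Y * sqrt (real N) \<longrightarrow>
      tilt \<alpha> N \<beta> x \<le> exp (\<alpha> * K\<^sup>2) * exp (- \<bar>x\<bar>)) sequentially"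
  proof (eventually_elim, intro allI impI)
    fix N \<beta> x assume N: "real N \<ge> max 1 (K\<^sup>2)" and \<beta>: "\<bar>\<beta>\<bar> \<le> Y * sqrt (real N)"
    define r where "r = sqrt (real N)"
    have r: "r > 0" "r * r = real N" "K \<le> r"
      using N \<open>K > 0\<close> by (auto simp: r_def real_le_rsqrt)
    have "K / r / 2 * \<bar>x / r\<bar> - (K / r)\<^sup>2 \<le> exp (x / r) - 1 - x / r"
      using r \<open>K > 0\<close> by (intro exp_minus_tangent_ge) auto
    then have "\<alpha> * (r * r) * (K / r / 2 * \<bar>x / r\<bar> - (K / r)\<^sup>2) \<le> \<alpha> * (r * r) * (exp (x / r) - 1 - x / r)"
      using assms r by (intro mult_left_mono) auto
    moreover have "\<alpha> * (r * r) * (K / r / 2 * \<bar>x / r\<bar> - (K / r)\<^sup>2) = \<alpha> * K / 2 * \<bar>x\<bar> - \<alpha> * K\<^sup>2"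
      using r(1) by (simp add: field_simps power2_eq_square)
    moreover have "\<alpha> * K / 2 * \<bar>x\<bar> = Y * \<bar>x\<bar> + \<bar>x\<bar>"
      using assms by (simp add: K_def distrib_right)
    moreover have "\<beta> * (x / r) \<le> Y * \<bar>x\<bar>"
    proof -
      have "\<beta> * (x / r) \<le> \<bar>\<beta>\<bar> * \<bar>x / r\<bar>"
        by (metis abs_ge_self abs_mult)
      also have "\<dots> \<le> (Y * r) * \<bar>x / r\<bar>"
        using \<beta> by (intro mult_right_mono) (auto simp: r_def)
      finally show ?thesis using r by simp
    qed
    ultimately have "\<beta> * (x / r) - \<alpha> * (r * r) * (exp (x / r) - 1 - x / r) \<le> \<alpha> * K\<^sup>2 + (- \<bar>x\<bar>)"
      by linarith
    then show "tilt \<alpha> N \<beta> x \<le> exp (\<alpha> * K\<^sup>2) * exp (- \<bar>x\<bar>)"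
      unfolding tilt_def exp_add[symmetric] by (simp add: r flip: r_def)
  qed
qed

lemma tilt_tendsto:
  assumes "(\<lambda>N. \<beta> N / sqrt (real N)) \<longlonglongrightarrow> y"
  shows "(\<lambda>N. tilt \<alpha> N (\<beta> N) x) \<longlonglongrightarrow> exp (y * x - \<alpha> * x\<^sup>2 / 2)"
proof -
  have "(\<lambda>N. real N * (exp (x / sqrt (real N)) - 1 - x / sqrt (real N))) \<longlonglongrightarrow> x\<^sup>2 / 2"
    by (real_asymp simp: power2_eq_square)
  then have "(\<lambda>N. exp (\<beta> N / sqrt (real N) * x -
      \<alpha> * (real N * (exp (x / sqrt (real N)) - 1 - x / sqrt (real N))))) \<longlonglongrightarrow> exp (y * x - \<alpha> * (x\<^sup>2 / 2))"
    by (intro tendsto_intros assms)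
  then show ?thesis by (simp add: tilt_def mult.assoc)
qed

lemma tilt_mass_tendsto:
  assumes "\<alpha> > 0" and lim: "(\<lambda>N. \<beta> N / sqrt (real N)) \<longlonglongrightarrow> y"
  shows "(\<lambda>N. tilt_mass \<alpha> N (\<beta> N)) \<longlonglongrightarrow> sqrt (2 * pi / \<alpha>) * exp (y\<^sup>2 / (2 * \<alpha>))"
proof -
  \<comment> \<open>The quotients \<open>\<beta> N / sqrt N\<close> tend to \<open>y\<close>, so
    \<open>\<bar>y\<bar> + 1\<close> bounds their absolute values from some \<open>N\<close>
    on.\<close>
  obtain C where C: "C > 0" "eventually (\<lambda>N. \<forall>\<beta> x. \<bar>\<beta>\<bar> \<le> (\<bar>y\<bar> + 1) * sqrt (real N) \<longrightarrow>
      tilt \<alpha> N \<beta> x \<le> C * exp (- \<bar>x\<bar>)) sequentially"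
    using tilt_le_exp_minus_abs[OF assms(1), of "\<bar>y\<bar> + 1"] by auto
  have "(\<lambda>N. tilt_mass \<alpha> N (\<beta> N)) \<longlonglongrightarrow> (\<integral>x. exp (y * x - \<alpha> * x\<^sup>2 / 2) \<partial>lborel)"
    unfolding tilt_mass_def
  proof (rule integral_dominated_convergence_eventually[where w = "\<lambda>x. C * exp (- \<bar>x\<bar>)"])
    show "integrable lborel (\<lambda>x::real. C * exp (- \<bar>x\<bar>))"
      by (intro integrable_mult_right integrable_exp_minus_abs)
    have "eventually (\<lambda>N. \<bar>\<beta> N / sqrt (real N)\<bar> < \<bar>y\<bar> + 1) sequentially"
      using tendsto_rabs[OF lim] by (intro order_tendstoD(2)[where y = "\<bar>y\<bar>"]) auto
    with C(2) eventually_gt_at_top[of 0]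
    show "eventually (\<lambda>N. \<forall>x\<in>space lborel. \<bar>tilt \<alpha> N (\<beta> N) x\<bar> \<le> C * exp (- \<bar>x\<bar>)) sequentially"
    proof eventually_elim
      case (elim N)
      then have "\<bar>\<beta> N\<bar> \<le> (\<bar>y\<bar> + 1) * sqrt (real N)"
        by (simp add: field_simps abs_mult)
      then show ?case using elim tilt_pos[of \<alpha> N "\<beta> N"] by (auto simp: abs_of_pos)
    qed
  qed (use tilt_tendsto[OF lim] in auto)
  also have "(\<integral>x. exp (y * x - \<alpha> * x\<^sup>2 / 2) \<partial>lborel) =
      (\<integral>x. sqrt (2 * pi / \<alpha>) * exp (y\<^sup>2 / (2 * \<alpha>)) * normal_density (y / \<alpha>) (1 / sqrt \<alpha>) x \<partial>lborel)"
  proof (rule Bochner_Integration.integral_cong[OF refl])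
    fix x :: real
    \<comment> \<open>Completing the square gives a normal density with mean
      \<open>y / \<alpha>\<close> and variance \<open>1 / \<alpha>\<close>.\<close>
    have "y * x - \<alpha> * x\<^sup>2 / 2 = y\<^sup>2 / (2 * \<alpha>) + - (x - y / \<alpha>)\<^sup>2 / (2 * (1 / sqrt \<alpha>)\<^sup>2)"
      using assms by (simp add: power_divide power2_diff field_simps) (simp add: power2_eq_square algebra_simps)
    then have "exp (y * x - \<alpha> * x\<^sup>2 / 2) =
        exp (y\<^sup>2 / (2 * \<alpha>)) * exp (- (x - y / \<alpha>)\<^sup>2 / (2 * (1 / sqrt \<alpha>)\<^sup>2))"
      by (simp only: exp_add)
    moreover have "2 * pi * (1 / sqrt \<alpha>)\<^sup>2 = 2 * pi / \<alpha>"
      using assms by (simp add: power_divide)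
    ultimately show "exp (y * x - \<alpha> * x\<^sup>2 / 2) =
        sqrt (2 * pi / \<alpha>) * exp (y\<^sup>2 / (2 * \<alpha>)) * normal_density (y / \<alpha>) (1 / sqrt \<alpha>) x"
      using assms by (simp add: normal_density_def)
  qed
  also have "\<dots> = sqrt (2 * pi / \<alpha>) * exp (y\<^sup>2 / (2 * \<alpha>))"
    using assms by simp
  finally show ?thesis .
qed

text \<open>Euler's integral for \<open>Gamma (\<alpha> * N + \<beta>)\<close> under the
  substitution \<open>\<alpha> * N * exp (x / sqrt N)\<close>. This exact identity takes the place
  of an asymptotic formula for Gamma: it trades every Gamma value for a
  \<open>tilt_mass\<close>.\<close>

lemma has_bochner_integral_tilt:
  assumes "\<alpha> > 0" "N > 0" "\<alpha> * N + \<beta> > 0"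
  shows "has_bochner_integral lborel (tilt \<alpha> N \<beta>)
    (sqrt N * exp (\<alpha> * N) * Gamma (\<alpha> * N + \<beta>) / (\<alpha> * N) powr (\<alpha> * N + \<beta>))"
proof (rule has_bochner_integral_nn_integral)
  define c where "c = \<alpha> * N"
  define q where "q = 1 / sqrt (real N)"
  define a where "a = c + \<beta>"
  have pos: "c > 0" "q > 0" "a > 0" using assms by (auto simp: c_def q_def a_def)
  have "ennreal (Gamma a) = (\<integral>\<^sup>+t. ennreal (t powr (a - 1) / exp t) * indicator {0<..} t \<partial>lborel)"
    unfolding Gamma_conv_nn_integral_real[OF pos(3)]
    by (intro nn_integral_cong) (auto simp: indicator_def)
  also have "\<dots> = (\<integral>\<^sup>+x. ennreal ((c * exp (q * x)) powr (a - 1) / exp (c * exp (q * x))) *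
      ennreal (c * q * exp (q * x)) \<partial>lborel)"
    using pos by (intro nn_integral_exp_substitution) auto
  also have "\<dots> = (\<integral>\<^sup>+x. ennreal (q * c powr a * exp (- c)) * ennreal (tilt \<alpha> N \<beta> x) \<partial>lborel)"
  proof (intro nn_integral_cong)
    fix x
    have t: "tilt \<alpha> N \<beta> x = exp (c - c * exp (q * x) + a * (q * x))"
      by (simp add: tilt_def c_def q_def a_def algebra_simps)
    have "(c * exp (q * x)) powr (a - 1) / exp (c * exp (q * x)) * (c * q * exp (q * x)) =
        q * c powr a * exp (- c) * tilt \<alpha> N \<beta> x"
      unfolding t using pos
      by (simp add: powr_mult powr_diff powr_def exp_add exp_diff exp_minus field_simps ln_mult)
    then show "ennreal ((c * exp (q * x)) powr (a - 1) / exp (c * exp (q * x))) *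
      ennreal (c * q * exp (q * x)) = ennreal (q * c powr a * exp (- c)) * ennreal (tilt \<alpha> N \<beta> x)"
      using pos tilt_pos[of \<alpha> N \<beta> x] by (simp flip: ennreal_mult)
  qed
  also have "\<dots> = ennreal (q * c powr a * exp (- c)) * (\<integral>\<^sup>+x. ennreal (tilt \<alpha> N \<beta> x) \<partial>lborel)"
    by (rule nn_integral_cmult) simp
  finally have "ennreal (1 / (q * c powr a * exp (- c))) * ennreal (Gamma a) =
     ennreal (1 / (q * c powr a * exp (- c))) * ennreal (q * c powr a * exp (- c)) *
       (\<integral>\<^sup>+x. ennreal (tilt \<alpha> N \<beta> x) \<partial>lborel)"
    by (simp add: mult.assoc)
  also have "ennreal (1 / (q * c powr a * exp (- c))) * ennreal (q * c powr a * exp (- c)) = 1"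
    using pos by (simp flip: ennreal_mult)
  finally have "(\<integral>\<^sup>+x. ennreal (tilt \<alpha> N \<beta> x) \<partial>lborel) = ennreal (1 / (q * c powr a * exp (- c)) * Gamma a)"
    using pos by (subst ennreal_mult) (auto simp: Gamma_real_pos less_imp_le)
  also have "1 / (q * c powr a * exp (- c)) * Gamma a = sqrt N * exp c * Gamma a / c powr a"
    by (simp add: q_def exp_minus field_simps)
  finally show "(\<integral>\<^sup>+x. ennreal (tilt \<alpha> N \<beta> x) \<partial>lborel) =
    ennreal (sqrt N * exp (\<alpha> * N) * Gamma (\<alpha> * N + \<beta>) / (\<alpha> * N) powr (\<alpha> * N + \<beta>))"
    by (simp add: a_def c_def)
  show "0 \<le> sqrt N * exp (\<alpha> * N) * Gamma (\<alpha> * N + \<beta>) / (\<alpha> * N) powr (\<alpha> * N + \<beta>)"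
    using assms by (simp add: Gamma_real_pos less_imp_le)
qed (auto simp: tilt_pos less_imp_le)

text \<open>The bound comes from the part of the integral over \<open>[1, 2]\<close> or \<open>[-2, -1]\<close>, where \<open>\<beta> * x \<ge> \<bar>\<beta>\<bar>\<close>.\<close>

lemma tilt_mass_ge:
  assumes "\<alpha> > 0" "N \<ge> 4" "\<alpha> * N + \<beta> > 0"
  shows "tilt_mass \<alpha> N \<beta> \<ge> exp (- 4 * \<alpha>) * exp (\<bar>\<beta>\<bar> / sqrt N)"
proof -
  define S where "S = (if \<beta> \<ge> 0 then {1..2} else {-2..-1::real})"
  have S: "S \<in> sets borel" "measure lborel S = 1" "emeasure lborel S < \<infinity>"
    by (auto simp: S_def)
  have int: "integrable lborel (tilt \<alpha> N \<beta>)"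
    using has_bochner_integral_tilt[of \<alpha> N \<beta>] assms by (auto simp: has_bochner_integral_iff)
  have "exp (- 4 * \<alpha>) * exp (\<bar>\<beta>\<bar> / sqrt N) =
      (\<integral>x. indicator S x * (exp (- 4 * \<alpha>) * exp (\<bar>\<beta>\<bar> / sqrt N)) \<partial>lborel)"
    using S by simp
  also have "\<dots> \<le> (\<integral>x. tilt \<alpha> N \<beta> x \<partial>lborel)"
  proof (intro integral_mono int integrable_mult_left integrable_real_indicator)
    fix x :: real
    show "indicator S x * (exp (- 4 * \<alpha>) * exp (\<bar>\<beta>\<bar> / sqrt N)) \<le> tilt \<alpha> N \<beta> x"
    proof (cases "x \<in> S")
      case True
      define r where "r = sqrt (real N)"
      \<comment> \<open>With \<open>N \<ge> 4\<close> and \<open>\<bar>x\<bar> \<le> 2\<close> the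
        quotient \<open>x / r\<close> stays in the range of the quadratic bound, which then costs at
        most \<open>4 * \<alpha>\<close>.\<close>
      have r: "r \<ge> 2" "r * r = real N"
        using assms(2) by (auto simp: r_def intro: real_le_rsqrt)
      have x: "\<bar>x\<bar> \<le> 2" "\<bar>\<beta>\<bar> * 1 \<le> \<beta> * x"
        using True mult_left_mono[of 1 x \<beta>] mult_left_mono_neg[of x "-1" \<beta>]
        by (auto simp: S_def abs_if split: if_splits)
      have "exp (x / r) - 1 - x / r \<le> (x / r)\<^sup>2"
        using x r by (intro exp_minus_tangent_le) auto
      then have "\<alpha> * (r * r) * (exp (x / r) - 1 - x / r) \<le> \<alpha> * (r * r) * (x / r)\<^sup>2"
        using assms r by (intro mult_left_mono) auto
      also have "\<dots> = \<alpha> * \<bar>x\<bar>\<^sup>2" using r(1) by (simp add: power2_eq_square)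
      also have "\<dots> \<le> \<alpha> * 2\<^sup>2" using x assms by (intro mult_left_mono power_mono) auto
      finally have "\<alpha> * (r * r) * (exp (x / r) - 1 - x / r) \<le> 4 * \<alpha>" by simp
      moreover have "\<bar>\<beta>\<bar> / r \<le> \<beta> * (x / r)"
        using x r by (simp add: divide_right_mono)
      ultimately have "- 4 * \<alpha> + \<bar>\<beta>\<bar> / r \<le> \<beta> * (x / r) - \<alpha> * (r * r) * (exp (x / r) - 1 - x / r)"
        by linarith
      then show ?thesis
        using True unfolding tilt_def exp_add[symmetric] by (simp add: r flip: r_def)
    qed (simp add: tilt_pos less_imp_le)
  qed (use S in auto)
  finally show ?thesis by (simp add: tilt_mass_def)
qed

section \<open>Gaussian integrals over product spaces\<close>

text \<open>The integral is the density at \<open>y\<close> of a sum of independent centered normal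
  variables, so the variances add. Each induction step is one convolution; \<open>y\<close> is
  generalized because the hypothesis is used at \<open>y - v\<close>.\<close>

lemma nn_integral_PiM_normal_density:
  fixes \<sigma> :: "'i \<Rightarrow> real"
  assumes "finite I" and "\<And>i. i \<in> I \<Longrightarrow> \<sigma> i > 0" and "\<tau> > 0"
  shows "(\<integral>\<^sup>+x. (\<Prod>i\<in>I. ennreal (normal_density 0 (\<sigma> i) (x i))) *
            ennreal (normal_density 0 \<tau> (y - (\<Sum>i\<in>I. x i))) \<partial>PiM I (\<lambda>_. lborel)) =
         ennreal (normal_density 0 (sqrt (\<tau>\<^sup>2 + (\<Sum>i\<in>I. (\<sigma> i)\<^sup>2))) y)"
  using assms(1,2)
proof (induction I arbitrary: y)
  case empty
  then show ?case using assms by (simp add: PiM_empty nn_integral_count_space_finite)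
next
  case (insert i I)
  interpret product_sigma_finite "\<lambda>_::'i. lborel :: real measure" by standard
  let ?n = "\<lambda>\<sigma> x. ennreal (normal_density 0 \<sigma> x)"
  let ?s = "sqrt (\<tau>\<^sup>2 + (\<Sum>i\<in>I. (\<sigma> i)\<^sup>2))"
  have "\<tau>\<^sup>2 + (\<Sum>i\<in>I. (\<sigma> i)\<^sup>2) > 0"
    using assms by (intro add_pos_nonneg sum_nonneg) auto
  then have s: "?s > 0" "?s\<^sup>2 = \<tau>\<^sup>2 + (\<Sum>i\<in>I. (\<sigma> i)\<^sup>2)" by auto
  have i: "\<sigma> i > 0" using insert.prems by auto
  have "(\<integral>\<^sup>+x. (\<Prod>i\<in>insert i I. ?n (\<sigma> i) (x i)) *
          ?n \<tau> (y - (\<Sum>i\<in>insert i I. x i)) \<partial>PiM (insert i I) (\<lambda>_. lborel)) =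
      (\<integral>\<^sup>+v. \<integral>\<^sup>+x. (\<Prod>j\<in>insert i I. ?n (\<sigma> j) ((x(i := v)) j)) *
          ?n \<tau> (y - (\<Sum>j\<in>insert i I. (x(i := v)) j)) \<partial>PiM I (\<lambda>_. lborel) \<partial>lborel)"
    using insert.hyps by (intro product_nn_integral_insert_rev) measurable
  also have "\<dots> = (\<integral>\<^sup>+v. ?n (\<sigma> i) v * ?n ?s (y - v) \<partial>lborel)"
  proof (intro nn_integral_cong)
    fix v :: real
    have 1: "(\<Prod>j\<in>I. ?n (\<sigma> j) ((x(i := v)) j)) = (\<Prod>j\<in>I. ?n (\<sigma> j) (x j))" for x
      using insert.hyps(2) by (intro prod.cong) auto
    have 2: "(\<Sum>j\<in>I. (x(i := v)) j) = (\<Sum>j\<in>I. x j)" for x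
      using insert.hyps(2) by (intro sum.cong) auto
    have "(\<integral>\<^sup>+x. (\<Prod>j\<in>insert i I. ?n (\<sigma> j) ((x(i := v)) j)) *
          ?n \<tau> (y - (\<Sum>j\<in>insert i I. (x(i := v)) j)) \<partial>PiM I (\<lambda>_. lborel)) =
       (\<integral>\<^sup>+x. ?n (\<sigma> i) v * ((\<Prod>j\<in>I. ?n (\<sigma> j) (x j)) * ?n \<tau> ((y - v) - (\<Sum>j\<in>I. x j))) \<partial>PiM I (\<lambda>_. lborel))"
      unfolding sum.insert[OF insert.hyps] prod.insert[OF insert.hyps] 1 2
      by (simp add: mult.assoc algebra_simps)
    also have "\<dots> = ?n (\<sigma> i) v * ?n ?s (y - v)"
      using insert.prems by (subst nn_integral_cmult) (measurable, simp add: insert.IH)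
    finally show "(\<integral>\<^sup>+x. (\<Prod>j\<in>insert i I. ?n (\<sigma> j) ((x(i := v)) j)) *
          ?n \<tau> (y - (\<Sum>j\<in>insert i I. (x(i := v)) j)) \<partial>PiM I (\<lambda>_. lborel)) = ?n (\<sigma> i) v * ?n ?s (y - v)" .
  qed
  also have "\<dots> = (\<integral>\<^sup>+v. ennreal (normal_density 0 ?s (y - v) * normal_density 0 (\<sigma> i) v) \<partial>lborel)"
    by (simp add: ennreal_mult' mult.commute)
  also have "\<dots> = ?n (sqrt (?s\<^sup>2 + (\<sigma> i)\<^sup>2)) y"
    using conv_normal_density_zero_mean[OF s(1) i] by (simp add: fun_eq_iff)
  also have "?s\<^sup>2 + (\<sigma> i)\<^sup>2 = \<tau>\<^sup>2 + (\<Sum>i\<in>insert i I. (\<sigma> i)\<^sup>2)"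
    unfolding s using insert.hyps by simp
  finally show ?case .
qed

lemma gaussian_eq_normal_density:
  assumes "\<alpha> > 0"
  shows "exp (- \<alpha> * x\<^sup>2 / 2) = sqrt (2 * pi / \<alpha>) * normal_density 0 (1 / sqrt \<alpha>) x"
proof -
  have "2 * pi * (1 / sqrt \<alpha>)\<^sup>2 = 2 * pi / \<alpha>" "2 * (1 / sqrt \<alpha>)\<^sup>2 = 2 / \<alpha>"
    using assms by (simp_all add: power_divide)
  then show ?thesis using assms by (simp add: normal_density_def mult.commute)
qed

text \<open>Once all factors are normalized to normal densities, the integral is the density at 0 of
  a sum of independent normal variables with variances \<open>1 / \<alpha> i\<close> and
  \<open>1 / \<beta>\<close>.\<close>

lemma integral_PiM_gaussian:
  fixes \<alpha> :: "'i \<Rightarrow> real"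
  assumes "finite I" and "\<And>i. i \<in> I \<Longrightarrow> \<alpha> i > 0" and "\<beta> > 0"
  shows "(\<integral>x. (\<Prod>i\<in>I. exp (- \<alpha> i * (x i)\<^sup>2 / 2)) * exp (- \<beta> * (\<Sum>i\<in>I. x i)\<^sup>2 / 2)
            \<partial>PiM I (\<lambda>_. lborel)) =
         (\<Prod>i\<in>I. sqrt (2 * pi / \<alpha> i)) * sqrt (2 * pi / \<beta>) /
           sqrt (2 * pi * (1 / \<beta> + (\<Sum>i\<in>I. 1 / \<alpha> i)))"
proof -
  let ?n = "normal_density 0"
  let ?C = "(\<Prod>i\<in>I. sqrt (2 * pi / \<alpha> i)) * sqrt (2 * pi / \<beta>)"
  have "(\<Prod>i\<in>I. exp (- \<alpha> i * (x i)\<^sup>2 / 2)) * exp (- \<beta> * (\<Sum>i\<in>I. x i)\<^sup>2 / 2) =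
     ?C * ((\<Prod>i\<in>I. ?n (1 / sqrt (\<alpha> i)) (x i)) * ?n (1 / sqrt \<beta>) (0 - (\<Sum>i\<in>I. x i)))" for x
  proof -
    have "(\<Prod>i\<in>I. exp (- \<alpha> i * (x i)\<^sup>2 / 2)) =
        (\<Prod>i\<in>I. sqrt (2 * pi / \<alpha> i) * ?n (1 / sqrt (\<alpha> i)) (x i))"
      using assms by (intro prod.cong gaussian_eq_normal_density) auto
    moreover have "exp (- \<beta> * (\<Sum>i\<in>I. x i)\<^sup>2 / 2) = sqrt (2 * pi / \<beta>) * ?n (1 / sqrt \<beta>) (0 - (\<Sum>i\<in>I. x i))"
      using gaussian_eq_normal_density[OF \<open>\<beta> > 0\<close>, of "0 - (\<Sum>i\<in>I. x i)"] by simp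
    ultimately show ?thesis by (simp only: prod.distrib mult_ac)
  qed
  then have "(\<integral>x. (\<Prod>i\<in>I. exp (- \<alpha> i * (x i)\<^sup>2 / 2)) * exp (- \<beta> * (\<Sum>i\<in>I. x i)\<^sup>2 / 2)
            \<partial>PiM I (\<lambda>_. lborel)) = ?C * (\<integral>x. (\<Prod>i\<in>I. ?n (1 / sqrt (\<alpha> i)) (x i)) *
            ?n (1 / sqrt \<beta>) (0 - (\<Sum>i\<in>I. x i)) \<partial>PiM I (\<lambda>_. lborel))"
    by simp
  also have "(\<integral>x. (\<Prod>i\<in>I. ?n (1 / sqrt (\<alpha> i)) (x i)) *
        ?n (1 / sqrt \<beta>) (0 - (\<Sum>i\<in>I. x i)) \<partial>PiM I (\<lambda>_. lborel)) =
      ?n (sqrt ((1 / sqrt \<beta>)\<^sup>2 + (\<Sum>i\<in>I. (1 / sqrt (\<alpha> i))\<^sup>2))) 0"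
  proof (subst integral_eq_nn_integral)
    have "(\<integral>\<^sup>+x. ennreal ((\<Prod>i\<in>I. ?n (1 / sqrt (\<alpha> i)) (x i)) * ?n (1 / sqrt \<beta>) (0 - (\<Sum>i\<in>I. x i)))
        \<partial>PiM I (\<lambda>_. lborel)) = ennreal (?n (sqrt ((1 / sqrt \<beta>)\<^sup>2 + (\<Sum>i\<in>I. (1 / sqrt (\<alpha> i))\<^sup>2))) 0)"
      using assms
      by (subst nn_integral_PiM_normal_density[symmetric])
         (auto simp: ennreal_mult' prod_ennreal prod_nonneg)
    then show "enn2real (\<integral>\<^sup>+x. ennreal ((\<Prod>i\<in>I. ?n (1 / sqrt (\<alpha> i)) (x i)) *
         ?n (1 / sqrt \<beta>) (0 - (\<Sum>i\<in>I. x i))) \<partial>PiM I (\<lambda>_. lborel)) =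
        ?n (sqrt ((1 / sqrt \<beta>)\<^sup>2 + (\<Sum>i\<in>I. (1 / sqrt (\<alpha> i))\<^sup>2))) 0"
      by simp
  next
    show "(\<lambda>x. (\<Prod>i\<in>I. ?n (1 / sqrt (\<alpha> i)) (x i)) * ?n (1 / sqrt \<beta>) (0 - (\<Sum>i\<in>I. x i)))
      \<in> borel_measurable (PiM I (\<lambda>_. lborel))"
      by measurable
  qed (intro AE_I2 mult_nonneg_nonneg prod_nonneg normal_density_nonneg)
  also have "(1 / sqrt \<beta>)\<^sup>2 + (\<Sum>i\<in>I. (1 / sqrt (\<alpha> i))\<^sup>2) = 1 / \<beta> + (\<Sum>i\<in>I. 1 / \<alpha> i)"
    using assms by (auto simp: power_divide less_imp_le intro!: sum.cong)
  moreover have "1 / \<beta> + (\<Sum>i\<in>I. 1 / \<alpha> i) \<ge> 0"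
    using assms by (intro add_nonneg_nonneg sum_nonneg) (auto simp: less_imp_le)
  ultimately show ?thesis by (simp add: normal_density_def)
qed

text \<open>The asymptotics of the integral in the weight: dominated convergence replaces each
  \<open>tilt\<close> by its Gaussian limit.\<close>

lemma integral_PiM_tilt_tendsto:
  fixes \<alpha> :: "'i \<Rightarrow> real"
  assumes "finite I" and "\<And>i. i \<in> I \<Longrightarrow> \<alpha> i > 0" and "\<beta> > 0"
  shows "(\<lambda>N. \<integral>x. (\<Prod>i\<in>I. tilt (\<alpha> i) N 0 (x i)) * tilt \<beta> N 0 (- (\<Sum>i\<in>I. x i)) \<partial>PiM I (\<lambda>_. lborel))
         \<longlonglongrightarrow> (\<Prod>i\<in>I. sqrt (2 * pi / \<alpha> i)) * sqrt (2 * pi / \<beta>) /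
           sqrt (2 * pi * (1 / \<beta> + (\<Sum>i\<in>I. 1 / \<alpha> i)))"
proof -
  interpret product_sigma_finite "\<lambda>_::'i. lborel :: real measure" by standard
  have bnd: "\<exists>C>0. eventually (\<lambda>N. \<forall>x. tilt a N 0 x \<le> C * exp (- \<bar>x\<bar>)) sequentially"
    if a: "a > 0" for a
  proof -
    obtain C where C: "C > 0" "eventually (\<lambda>N. \<forall>\<beta> x. \<bar>\<beta>\<bar> \<le> 0 * sqrt (real N) \<longrightarrow>
        tilt a N \<beta> x \<le> C * exp (- \<bar>x\<bar>)) sequentially"
      using tilt_le_exp_minus_abs[OF a order_refl] by blast
    from C(2) have "eventually (\<lambda>N. \<forall>x. tilt a N 0 x \<le> C * exp (- \<bar>x\<bar>)) sequentially"
      by eventually_elim simp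
    with C(1) show ?thesis by blast
  qed
  obtain D where D: "D > 0" "eventually (\<lambda>N. \<forall>x. tilt \<beta> N 0 x \<le> D * exp (- \<bar>x\<bar>)) sequentially"
    using bnd[OF assms(3)] by blast
  have "\<forall>i\<in>I. \<exists>C>0. eventually (\<lambda>N. \<forall>x. tilt (\<alpha> i) N 0 x \<le> C * exp (- \<bar>x\<bar>)) sequentially"
    using assms(2) by (intro ballI bnd)
  from bchoice[OF this] obtain C where C: "\<And>i. i \<in> I \<Longrightarrow> C i > 0"
    "\<And>i. i \<in> I \<Longrightarrow> eventually (\<lambda>N. \<forall>x. tilt (\<alpha> i) N 0 x \<le> C i * exp (- \<bar>x\<bar>)) sequentially"
    by blast
  have "(\<lambda>N. \<integral>x. (\<Prod>i\<in>I. tilt (\<alpha> i) N 0 (x i)) * tilt \<beta> N 0 (- (\<Sum>i\<in>I. x i)) \<partial>PiM I (\<lambda>_. lborel))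
     \<longlonglongrightarrow> (\<integral>x. (\<Prod>i\<in>I. exp (- \<alpha> i * (x i)\<^sup>2 / 2)) * exp (- \<beta> * (\<Sum>i\<in>I. x i)\<^sup>2 / 2)
            \<partial>PiM I (\<lambda>_. lborel))"
  proof (rule integral_dominated_convergence_eventually
      [where w = "\<lambda>x. (\<Prod>i\<in>I. C i * exp (- \<bar>x i\<bar>)) * D"])
    \<comment> \<open>The last factor depends on the coordinates only through their sum and is
      bounded by the constant \<open>D\<close>; the decay in each coordinate comes from its own
      factor.\<close>
    show "integrable (PiM I (\<lambda>_. lborel)) (\<lambda>x. (\<Prod>i\<in>I. C i * exp (- \<bar>x i\<bar>)) * D)"
      by (intro integrable_mult_left product_integrable_prod integrable_mult_right
          integrable_exp_minus_abs assms)
    have "eventually (\<lambda>N. \<forall>i\<in>I. \<forall>x. tilt (\<alpha> i) N 0 x \<le> C i * exp (- \<bar>x\<bar>)) sequentially"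
      using C(2) assms(1) by (simp add: eventually_ball_finite)
    with D(2) show "eventually (\<lambda>N. \<forall>x\<in>space (PiM I (\<lambda>_. lborel)).
        \<bar>(\<Prod>i\<in>I. tilt (\<alpha> i) N 0 (x i)) * tilt \<beta> N 0 (- (\<Sum>i\<in>I. x i))\<bar> \<le>
        (\<Prod>i\<in>I. C i * exp (- \<bar>x i\<bar>)) * D) sequentially"
    proof (eventually_elim, intro ballI)
      fix N and x :: "'i \<Rightarrow> real"
      assume N: "\<forall>x. tilt \<beta> N 0 x \<le> D * exp (- \<bar>x\<bar>)"
        "\<forall>i\<in>I. \<forall>x. tilt (\<alpha> i) N 0 x \<le> C i * exp (- \<bar>x\<bar>)"
      let ?u = "- (\<Sum>i\<in>I. x i)"
      have "tilt \<beta> N 0 ?u \<le> D * exp (- \<bar>?u\<bar>)" using N(1) by blast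
      also have "\<dots> \<le> D * 1" using D(1) by (intro mult_left_mono) auto
      finally have 1: "tilt \<beta> N 0 ?u \<le> D" by simp
      have 2: "(\<Prod>i\<in>I. tilt (\<alpha> i) N 0 (x i)) \<le> (\<Prod>i\<in>I. C i * exp (- \<bar>x i\<bar>))"
        using N(2) by (intro prod_mono) (auto simp: tilt_pos less_imp_le)
      have "\<bar>(\<Prod>i\<in>I. tilt (\<alpha> i) N 0 (x i)) * tilt \<beta> N 0 ?u\<bar> =
          (\<Prod>i\<in>I. tilt (\<alpha> i) N 0 (x i)) * tilt \<beta> N 0 ?u"
        by (intro abs_of_nonneg mult_nonneg_nonneg prod_nonneg) (auto simp: tilt_pos less_imp_le)
      also have "\<dots> \<le> (\<Prod>i\<in>I. C i * exp (- \<bar>x i\<bar>)) * D"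
        using C(1) by (intro mult_mono 1 2 prod_nonneg) (auto simp: tilt_pos less_imp_le)
      finally show "\<bar>(\<Prod>i\<in>I. tilt (\<alpha> i) N 0 (x i)) * tilt \<beta> N 0 ?u\<bar> \<le>
          (\<Prod>i\<in>I. C i * exp (- \<bar>x i\<bar>)) * D" .
    qed
    show "AE x in PiM I (\<lambda>_. lborel).
        (\<lambda>N. (\<Prod>i\<in>I. tilt (\<alpha> i) N 0 (x i)) * tilt \<beta> N 0 (- (\<Sum>i\<in>I. x i))) \<longlonglongrightarrow>
        (\<Prod>i\<in>I. exp (- \<alpha> i * (x i)\<^sup>2 / 2)) * exp (- \<beta> * (\<Sum>i\<in>I. x i)\<^sup>2 / 2)"
    proof (intro AE_I2 tendsto_mult tendsto_prod)
      have *: "(\<lambda>N. tilt a N 0 u) \<longlonglongrightarrow> exp (- a * u\<^sup>2 / 2)" for a u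
        using tilt_tendsto[of "\<lambda>_. 0" 0 a u] by simp
      show "(\<lambda>N. tilt (\<alpha> i) N 0 (x i)) \<longlonglongrightarrow> exp (- \<alpha> i * (x i)\<^sup>2 / 2)" for x i
        by (rule *)
      show "(\<lambda>N. tilt \<beta> N 0 (- (\<Sum>i\<in>I. x i))) \<longlonglongrightarrow> exp (- \<beta> * (\<Sum>i\<in>I. x i)\<^sup>2 / 2)" for x
        using *[of \<beta> "- (\<Sum>i\<in>I. x i)"] by simp
    qed
  qed measurable
  also have "(\<integral>x. (\<Prod>i\<in>I. exp (- \<alpha> i * (x i)\<^sup>2 / 2)) * exp (- \<beta> * (\<Sum>i\<in>I. x i)\<^sup>2 / 2)
            \<partial>PiM I (\<lambda>_. lborel)) = (\<Prod>i\<in>I. sqrt (2 * pi / \<alpha> i)) * sqrt (2 * pi / \<beta>) /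
           sqrt (2 * pi * (1 / \<beta> + (\<Sum>i\<in>I. 1 / \<alpha> i)))"
    by (rule integral_PiM_gaussian[OF assms])
  finally show ?thesis .
qed

section \<open>From scaled sums to Gaussian integrals\<close>

text \<open>The limiting share of the indices near \<open>t * N\<close> that lie between 0 and
  \<open>N\<close>, measured by an even function of the deviation from \<open>t * N\<close>. At the
  two ends only one side counts.\<close>

definition unit_interval_weight :: "real \<Rightarrow> real" where
  "unit_interval_weight t = (if 0 < t \<and> t < 1 then 1 else if t = 0 \<or> t = 1 then 1 / 2 else 0)"

text \<open>Reflection exchanges the two half-lines up to the null set consisting of 0.\<close>

lemma integral_halfline_even:
  fixes g :: "real \<Rightarrow> real"
  assumes g: "integrable lborel g" and even: "\<And>y. g (- y) = g y"
  shows "(\<integral>y. indicator {0..} y * g y \<partial>lborel) = (\<integral>y. g y \<partial>lborel) / 2"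
    and "(\<integral>y. indicator {..<0} y * g y \<partial>lborel) = (\<integral>y. g y \<partial>lborel) / 2"
proof -
  have int: "integrable lborel (\<lambda>y. indicator S y * g y)" if "S \<in> sets borel" for S
    using integrable_mult_indicator[of S lborel g] that g by simp
  have "(\<integral>y. indicator {..<0} y * g y \<partial>lborel) = (\<integral>y. indicator {..<0} (- y) * g (- y) \<partial>lborel)"
    by (subst lborel_integral_real_affine[where c = "-1" and t = 0]) auto
  also have "\<dots> = (\<integral>y. indicator {0..} y * g y \<partial>lborel)"
  proof (rule integral_cong_AE)
    have "AE y in lborel. y \<noteq> (0::real)" by (rule AE_lborel_singleton)
    then show "AE y in lborel. indicator {..<0} (- y) * g (- y) = indicator {0..} y * g y"
      by eventually_elim (auto simp: even indicator_def)
  qed (use g in \<open>auto simp: even\<close>)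
  finally have eq: "(\<integral>y. indicator {..<0} y * g y \<partial>lborel) = (\<integral>y. indicator {0..} y * g y \<partial>lborel)" .
  have "(\<integral>y. g y \<partial>lborel) = (\<integral>y. indicator {..<0} y * g y + indicator {0..} y * g y \<partial>lborel)"
    by (intro Bochner_Integration.integral_cong) (auto simp: indicator_def)
  also have "\<dots> = (\<integral>y. indicator {..<0} y * g y \<partial>lborel) + (\<integral>y. indicator {0..} y * g y \<partial>lborel)"
    by (intro Bochner_Integration.integral_add int) auto
  finally show "(\<integral>y. indicator {0..} y * g y \<partial>lborel) = (\<integral>y. g y \<partial>lborel) / 2"
    and "(\<integral>y. indicator {..<0} y * g y \<partial>lborel) = (\<integral>y. g y \<partial>lborel) / 2"
    using eq by auto
qed

text \<open>
  The scaled sum is the integral of the step function that takes, at \<open>y\<close>, the summand with index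
  \<open>l = \<lfloor>t * N + y * sqrt N\<rfloor>\<close> if \<open>0 \<le> l < N\<close>. For \<open>t = 0\<close> and \<open>t = 1\<close> only a half-line of \<open>y\<close> survives
  in the limit, which produces the value \<open>1 / 2\<close>.
\<close>

lemma scaled_sum_tendsto:
  fixes f :: "nat \<Rightarrow> real \<Rightarrow> real" and g :: "real \<Rightarrow> real" and t :: real
  assumes lim: "\<And>\<beta> y. (\<lambda>N. \<beta> N / sqrt (real N)) \<longlonglongrightarrow> y \<Longrightarrow> (\<lambda>N. f N (\<beta> N)) \<longlonglongrightarrow> g y"
    and bound: "eventually (\<lambda>N. \<forall>l::nat. \<bar>f N (real l + 1 - t * N)\<bar> \<le>
                  C * exp (- \<bar>real l + 1 - t * N\<bar> / sqrt (real N))) sequentially"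
    and g: "integrable lborel g" and even: "\<And>y. g (- y) = g y"
  shows "(\<lambda>N. (\<Sum>l<N. f N (real l + 1 - t * N)) / sqrt (real N))
         \<longlonglongrightarrow> unit_interval_weight t * (\<integral>y. g y \<partial>lborel)"
proof -
  \<comment> \<open>These intervals have length \<open>1 / sqrt N\<close>, so the integral of
    \<open>F N\<close> below is the scaled sum. They are half-open to match the floor
    function.\<close>
  let ?J = "\<lambda>N l. {(real l - t * real N) / sqrt (real N) ..< (real l + 1 - t * real N) / sqrt (real N)}"
  define F where "F N y = (\<Sum>l<N. indicator (?J N l) y * f N (real l + 1 - t * N))" for N y
  define W :: "nat \<Rightarrow> real \<Rightarrow> real"
    where "W N y = of_bool (0 \<le> t * N + y * sqrt (real N) \<and> t * N + y * sqrt (real N) < N)" for N y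
  define \<beta> where "\<beta> y N = real_of_int \<lfloor>t * real N + y * sqrt (real N)\<rfloor> + 1 - t * N" for y N
  \<comment> \<open>The hypothesis \<open>bound\<close> speaks only of arguments
    \<open>l + 1 - t * N\<close> with a natural number \<open>l\<close>; the second claim makes it
    available wherever \<open>W N y\<close> does not vanish.\<close>
  have F: "F N y = W N y * f N (\<beta> y N)" and le: "W N y \<noteq> 0 \<Longrightarrow> \<exists>l::nat. \<beta> y N = real l + 1 - t * N"
    if "N > 0" for N y
  proof -
    define k where "k = \<lfloor>t * real N + y * sqrt (real N)\<rfloor>"
    have mem: "y \<in> ?J N l \<longleftrightarrow> k = int l" for l
      using that unfolding k_def floor_eq_iff by (auto simp: field_simps)
    have W: "W N y = of_bool (0 \<le> k \<and> k < int N)"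
      unfolding W_def k_def by (simp add: floor_less_iff)
    show "F N y = W N y * f N (\<beta> y N)"
    proof (cases "0 \<le> k \<and> k < int N")
      case True
      then obtain n where n: "k = int n" "n < N"
        by (metis nonneg_int_cases of_nat_less_iff)
      have "F N y = (\<Sum>l<N. if l = n then f N (real l + 1 - t * N) else 0)"
        unfolding F_def using mem n by (intro sum.cong) (auto simp: indicator_def)
      also have "\<dots> = f N (real n + 1 - t * N)"
        using n by (simp add: sum.delta)
      finally show ?thesis
        using n by (simp add: W \<beta>_def flip: k_def)
    next
      case False
      have "F N y = 0"
        unfolding F_def using mem False by (intro sum.neutral) (auto simp: indicator_def)
      then show ?thesis using False by (auto simp: W)
    qed
    show "\<exists>l::nat. \<beta> y N = real l + 1 - t * N" if "W N y \<noteq> 0"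
      using that unfolding W \<beta>_def k_def[symmetric]
      by (intro exI[of _ "nat k"]) auto
  qed
  \<comment> \<open>The pointwise limit of \<open>W\<close>. At \<open>t = 0\<close> the condition
    \<open>l \<ge> 0\<close> keeps \<open>y = 0\<close>, and at \<open>t = 1\<close> the condition
    \<open>l < N\<close> excludes it; with this choice the limit holds at every
    \<open>y\<close>.\<close>
  define H where "H y = (if 0 < t \<and> t < 1 then 1 else if t = 0 then indicator {0..} y
      else if t = 1 then indicator {..<0} y else (0::real))" for y :: real
  have [measurable]: "g \<in> borel_measurable borel" "H \<in> borel_measurable borel"
    using g unfolding H_def by auto
  have "(\<lambda>N. \<integral>y. F N y \<partial>lborel) \<longlonglongrightarrow> (\<integral>y. H y * g y \<partial>lborel)"
  proof (rule integral_dominated_convergence_eventually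
      [where w = "\<lambda>y. \<bar>C\<bar> * exp 1 * exp (- \<bar>y\<bar>)"])
    show "integrable lborel (\<lambda>y::real. \<bar>C\<bar> * exp 1 * exp (- \<bar>y\<bar>))"
      by (intro integrable_mult_right integrable_exp_minus_abs)
    show "F N \<in> borel_measurable lborel" for N
      unfolding F_def by measurable
    show "AE y in lborel. (\<lambda>N. F N y) \<longlonglongrightarrow> H y * g y"
    proof (intro AE_I2)
      fix y
      \<comment> \<open>Rounding moves \<open>\<beta> y N\<close> away from
        \<open>y * sqrt N\<close> by at most 1, which vanishes after division by
        \<open>sqrt N\<close>.\<close>
      have "(\<lambda>N. \<beta> y N / sqrt (real N)) \<longlonglongrightarrow> y"
      proof (rule tendsto_sandwich)
        show "eventually (\<lambda>N. y \<le> \<beta> y N / sqrt (real N)) sequentially"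
          using eventually_gt_at_top[of 0]
        proof eventually_elim
          case (elim N)
          have "y * sqrt (real N) \<le> \<beta> y N" unfolding \<beta>_def by linarith
          with elim show ?case by (simp add: pos_le_divide_eq)
        qed
        show "eventually (\<lambda>N. \<beta> y N / sqrt (real N) \<le> y + 1 / sqrt (real N)) sequentially"
          using eventually_gt_at_top[of 0]
        proof eventually_elim
          case (elim N)
          have "\<beta> y N \<le> y * sqrt (real N) + 1" unfolding \<beta>_def by linarith
          with elim show ?case by (simp add: pos_divide_le_eq distrib_right)
        qed
        show "(\<lambda>N. y + 1 / sqrt (real N)) \<longlonglongrightarrow> y" by real_asymp
      qed simp
      from lim[OF this] have "(\<lambda>N. f N (\<beta> y N)) \<longlonglongrightarrow> g y" .
      moreover have "(\<lambda>N. W N y) \<longlonglongrightarrow> H y"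
      proof (rule tendsto_eventually)
        have lim_t: "(\<lambda>N. t + y / sqrt (real N)) \<longlonglongrightarrow> t" by real_asymp
        have W: "W N y = of_bool (0 \<le> t + y / sqrt (real N) \<and> t + y / sqrt (real N) < 1)" if "N > 0" for N
        proof -
          have "t * N + y * sqrt (real N) = real N * (t + y / sqrt (real N))"
            using that by (simp add: distrib_left real_div_sqrt flip: times_divide_eq_left)
          then show ?thesis using that by (simp add: W_def zero_le_mult_iff)
        qed
        consider "t < 0" | "t = 0" | "0 < t" "t < 1" | "t = 1" | "t > 1" by linarith
        then show "eventually (\<lambda>N. W N y = H y) sequentially"
        proof cases
          case 1
          from order_tendstoD(2)[OF lim_t 1] eventually_gt_at_top[of 0] show ?thesis
          proof eventually_elim
            case (elim N)
            then show ?case using 1 by (simp add: W H_def)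
          qed
        next
          case 2
          then have "t < 1" by simp
          from order_tendstoD(2)[OF lim_t this] eventually_gt_at_top[of 0] show ?thesis
          proof eventually_elim
            case (elim N)
            then show ?case using 2 by (simp add: W H_def zero_le_divide_iff indicator_def)
          qed
        next
          case 3
          from order_tendstoD(1)[OF lim_t 3(1)] order_tendstoD(2)[OF lim_t 3(2)] eventually_gt_at_top[of 0]
          show ?thesis
          proof eventually_elim
            case (elim N)
            then show ?case using 3 by (simp add: W H_def)
          qed
        next
          case 4
          then have "t > 0" by simp
          from order_tendstoD(1)[OF lim_t this] eventually_gt_at_top[of 0] show ?thesis
          proof eventually_elim
            case (elim N)
            then show ?case using 4 by (simp add: W H_def divide_less_0_iff indicator_def)
          qed
        next
          case 5
          from order_tendstoD(1)[OF lim_t 5] eventually_gt_at_top[of 0] show ?thesis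
          proof eventually_elim
            case (elim N)
            then show ?case using 5 by (simp add: W H_def)
          qed
        qed
      qed
      ultimately have "(\<lambda>N. W N y * f N (\<beta> y N)) \<longlonglongrightarrow> H y * g y"
        by (intro tendsto_mult)
      moreover have "eventually (\<lambda>N. W N y * f N (\<beta> y N) = F N y) sequentially"
        using eventually_gt_at_top[of 0] by eventually_elim (simp add: F)
      ultimately show "(\<lambda>N. F N y) \<longlonglongrightarrow> H y * g y"
        by (rule Lim_transform_eventually)
    qed
    show "eventually (\<lambda>N. \<forall>y\<in>space lborel. \<bar>F N y\<bar> \<le> \<bar>C\<bar> * exp 1 * exp (- \<bar>y\<bar>)) sequentially"
      using bound eventually_gt_at_top[of 0]
    proof (eventually_elim, intro ballI)
      fix N :: nat and y :: real
      assume N: "\<forall>l::nat. \<bar>f N (real l + 1 - t * N)\<bar> \<le>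
                  C * exp (- \<bar>real l + 1 - t * N\<bar> / sqrt (real N))" "N > 0"
      show "\<bar>F N y\<bar> \<le> \<bar>C\<bar> * exp 1 * exp (- \<bar>y\<bar>)"
      proof (cases "W N y = 0")
        case False
        then obtain l :: nat where l: "\<beta> y N = real l + 1 - t * N" using le[OF N(2)] by blast
        have r: "sqrt (real N) \<ge> 1" using N(2) by simp
        \<comment> \<open>The rounding error 1 is at most \<open>sqrt N\<close>, so passing from
          \<open>\<beta> y N\<close> to \<open>y\<close> in the exponent costs only a factor
          \<open>exp 1\<close>.\<close>
        have "\<bar>y * sqrt (real N)\<bar> - 1 \<le> \<bar>\<beta> y N\<bar>"
          unfolding \<beta>_def by linarith
        moreover have "\<bar>y * sqrt (real N)\<bar> = \<bar>y\<bar> * sqrt (real N)"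
          by (simp add: abs_mult)
        ultimately have "\<bar>y\<bar> * sqrt (real N) \<le> \<bar>\<beta> y N\<bar> + 1 * sqrt (real N)"
          using r by linarith
        then have "\<bar>y\<bar> \<le> \<bar>\<beta> y N\<bar> / sqrt (real N) + 1"
          using r by (simp add: field_simps)
        then have exp_le: "exp (- \<bar>\<beta> y N\<bar> / sqrt (real N)) \<le> exp 1 * exp (- \<bar>y\<bar>)"
          unfolding exp_add[symmetric] by simp
        have "\<bar>F N y\<bar> = \<bar>f N (\<beta> y N)\<bar>"
          using False N(2) by (simp add: F abs_mult W_def)
        also have "\<dots> \<le> C * exp (- \<bar>\<beta> y N\<bar> / sqrt (real N))"
          using N(1) unfolding l by blast
        also have "\<dots> \<le> \<bar>C\<bar> * (exp 1 * exp (- \<bar>y\<bar>))"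
          using exp_le by (intro mult_mono) auto
        finally show ?thesis by (simp add: mult.assoc)
      qed (use N in \<open>simp add: F\<close>)
    qed
  qed simp
  also have "(\<integral>y. H y * g y \<partial>lborel) = unit_interval_weight t * (\<integral>y. g y \<partial>lborel)"
    using integral_halfline_even[OF g even] by (auto simp: H_def unit_interval_weight_def)
  finally have "(\<lambda>N. \<integral>y. F N y \<partial>lborel) \<longlonglongrightarrow> unit_interval_weight t * (\<integral>y. g y \<partial>lborel)" .
  moreover have "eventually (\<lambda>N. (\<integral>y. F N y \<partial>lborel) = (\<Sum>l<N. f N (real l + 1 - t * N)) / sqrt (real N)) sequentially"
    using eventually_gt_at_top[of 0]
  proof eventually_elim
    case (elim N)
    have le: "(real l - t * real N) / sqrt (real N) \<le> (real l + 1 - t * real N) / sqrt (real N)" for l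
      by (simp add: divide_right_mono)
    have "(\<integral>y. F N y \<partial>lborel) = (\<Sum>l<N. \<integral>y. indicator (?J N l) y * f N (real l + 1 - t * N) \<partial>lborel)"
      unfolding F_def using le
      by (intro Bochner_Integration.integral_sum integrable_mult_left integrable_real_indicator) auto
    also have "\<dots> = (\<Sum>l<N. f N (real l + 1 - t * N) / sqrt (real N))"
      using le by (intro sum.cong) (auto simp: diff_divide_distrib add_divide_distrib)
    finally show ?case by (simp add: sum_divide_distrib)
  qed
  ultimately show ?thesis by (rule Lim_transform_eventually)
qed

section \<open>The weight integral in exponential coordinates\<close>

text \<open>The substitution is centered at the saddle point. With \<open>b = \<beta> * N\<close>,
  the value \<open>(\<Prod>i\<in>I. \<alpha> i * N) * b\<close> put in place of the squared modulus
  reduces the quotient in the exponent to \<open>b * exp (- (\<Sum>i\<in>I. v i))\<close>. This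
  yields one further \<open>tilt\<close>, evaluated at minus the sum of the coordinates.\<close>

lemma weight_integrand_exp_substitution:
  fixes \<alpha> x :: "'i \<Rightarrow> real" and \<beta> :: real and N :: nat
  assumes "finite I" and \<alpha>: "\<And>i. i \<in> I \<Longrightarrow> \<alpha> i > 0" and "\<beta> > 0" and "N > 0"
  defines "r \<equiv> \<lambda>i. sqrt (\<alpha> i * N) * exp (1 / (2 * sqrt N) * x i)"
  shows "exp (- (\<Sum>i\<in>I. (r i)\<^sup>2) - (\<Prod>i\<in>I. \<alpha> i * N) * (\<beta> * N) / (\<Prod>i\<in>I. (r i)\<^sup>2)) *
           (\<Prod>i\<in>I. r i powr (2 * (\<alpha> i * N - \<beta> * N) - 1)) *
           (\<Prod>i\<in>I. sqrt (\<alpha> i * N) * (1 / (2 * sqrt N)) * exp (1 / (2 * sqrt N) * x i)) =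
         (1 / (2 * sqrt N)) ^ card I * (\<Prod>i\<in>I. (\<alpha> i * N) powr (\<alpha> i * N - \<beta> * N)) *
           exp (- ((\<Sum>i\<in>I. \<alpha> i * N) + \<beta> * N)) *
           ((\<Prod>i\<in>I. tilt (\<alpha> i) N 0 (x i)) * tilt \<beta> N 0 (- (\<Sum>i\<in>I. x i)))"
proof -
  define v where "v i = x i / sqrt N" for i
  define c where "c i = \<alpha> i * N" for i
  define b where "b = \<beta> * N"
  define q where "q = 1 / (2 * sqrt N)"
  have c: "c i > 0" if "i \<in> I" for i using \<alpha>[OF that] assms by (simp add: c_def)
  have qx: "q * x i = v i / 2" for i by (simp add: q_def v_def)
  have r: "r i = sqrt (c i) * exp (v i / 2)" for i
    unfolding r_def c_def[symmetric] q_def[symmetric] qx ..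
  have r2: "(r i)\<^sup>2 = c i * exp (v i)" if "i \<in> I" for i
    using c[OF that] unfolding r by (simp add: power_mult_distrib flip: exp_double)
  have rpos: "r i > 0" if "i \<in> I" for i using c[OF that] by (simp add: r)
  have fac: "r i powr (2 * (c i - b) - 1) * (sqrt (c i) * q * exp (v i / 2)) =
      q * c i powr (c i - b) * exp ((c i - b) * v i)" if "i \<in> I" for i
  proof -
    \<comment> \<open>The Jacobian factor equals \<open>q * r i\<close> and cancels the
      \<open>- 1\<close> in the exponent.\<close>
    have "r i powr (2 * (c i - b) - 1) * (sqrt (c i) * q * exp (v i / 2)) =
        q * (r i powr (2 * (c i - b) - 1) * r i powr 1)"
      using rpos[OF that] by (simp add: r)
    also have "\<dots> = q * (r i powr 2) powr (c i - b)"
      unfolding powr_add[symmetric] powr_powr by simp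
    also have "r i powr 2 = c i * exp (v i)"
      using r2[OF that] rpos[OF that] by simp
    also have "(c i * exp (v i)) powr (c i - b) = c i powr (c i - b) * exp ((c i - b) * v i)"
      using c[OF that] by (simp add: powr_mult exp_powr_real mult.commute)
    finally show ?thesis by (simp add: mult.assoc)
  qed
  have prodr2: "(\<Prod>i\<in>I. (r i)\<^sup>2) = (\<Prod>i\<in>I. c i) * exp (\<Sum>i\<in>I. v i)"
    using r2 assms(1) by (simp add: prod.distrib exp_sum)
  have prodc: "(\<Prod>i\<in>I. c i) > 0" using c by (intro prod_pos) auto
  have div: "(\<Prod>i\<in>I. c i) * b / (\<Prod>i\<in>I. (r i)\<^sup>2) = b * exp (- (\<Sum>i\<in>I. v i))"
    using prodc unfolding prodr2 by (simp add: exp_minus field_simps)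
  have sumr2: "(\<Sum>i\<in>I. (r i)\<^sup>2) = (\<Sum>i\<in>I. c i * exp (v i))"
    using r2 by simp
  have tilts: "(\<Prod>i\<in>I. tilt (\<alpha> i) N 0 (x i)) = exp (\<Sum>i\<in>I. - (c i * (exp (v i) - 1 - v i)))"
    using assms(1) by (simp add: tilt_def exp_sum c_def v_def)
  have tiltb: "tilt \<beta> N 0 (- (\<Sum>i\<in>I. x i)) = exp (- (b * (exp (- (\<Sum>i\<in>I. v i)) - 1 + (\<Sum>i\<in>I. v i))))"
    by (simp add: tilt_def b_def v_def sum_divide_distrib)
  have "exp (- (\<Sum>i\<in>I. (r i)\<^sup>2) - (\<Prod>i\<in>I. c i) * b / (\<Prod>i\<in>I. (r i)\<^sup>2)) *
           (\<Prod>i\<in>I. r i powr (2 * (c i - b) - 1)) * (\<Prod>i\<in>I. sqrt (c i) * q * exp (v i / 2)) =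
      exp (- (\<Sum>i\<in>I. c i * exp (v i)) - b * exp (- (\<Sum>i\<in>I. v i))) *
        (\<Prod>i\<in>I. r i powr (2 * (c i - b) - 1) * (sqrt (c i) * q * exp (v i / 2)))"
    unfolding div sumr2 by (simp only: prod.distrib mult.assoc)
  also have "(\<Prod>i\<in>I. r i powr (2 * (c i - b) - 1) * (sqrt (c i) * q * exp (v i / 2))) =
      (\<Prod>i\<in>I. q * c i powr (c i - b) * exp ((c i - b) * v i))"
    using fac by (intro prod.cong) auto
  also have "\<dots> = q ^ card I * (\<Prod>i\<in>I. c i powr (c i - b)) * exp (\<Sum>i\<in>I. (c i - b) * v i)"
    using assms(1) by (simp add: prod.distrib exp_sum)
  also have "exp (- (\<Sum>i\<in>I. c i * exp (v i)) - b * exp (- (\<Sum>i\<in>I. v i))) *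
      (q ^ card I * (\<Prod>i\<in>I. c i powr (c i - b)) * exp (\<Sum>i\<in>I. (c i - b) * v i)) =
      q ^ card I * (\<Prod>i\<in>I. c i powr (c i - b)) *
      exp (- (\<Sum>i\<in>I. c i * exp (v i)) - b * exp (- (\<Sum>i\<in>I. v i)) + (\<Sum>i\<in>I. (c i - b) * v i))"
    by (simp only: exp_add mult_ac)
  \<comment> \<open>The linear terms contributed by the powers are exactly those that complete each
    exponential to \<open>exp v - 1 - v\<close>.\<close>
  also have "- (\<Sum>i\<in>I. c i * exp (v i)) - b * exp (- (\<Sum>i\<in>I. v i)) + (\<Sum>i\<in>I. (c i - b) * v i) =
      - ((\<Sum>i\<in>I. c i) + b) + ((\<Sum>i\<in>I. - (c i * (exp (v i) - 1 - v i))) +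
      - (b * (exp (- (\<Sum>i\<in>I. v i)) - 1 + (\<Sum>i\<in>I. v i))))"
    by (simp add: algebra_simps sum.distrib sum_subtractf sum_distrib_left sum_negf)
  also have "exp \<dots> = exp (- ((\<Sum>i\<in>I. c i) + b)) *
      ((\<Prod>i\<in>I. tilt (\<alpha> i) N 0 (x i)) * tilt \<beta> N 0 (- (\<Sum>i\<in>I. x i)))"
    unfolding tilts tiltb by (simp only: exp_add)
  finally show ?thesis
    unfolding c_def[symmetric] b_def[symmetric] q_def[symmetric] qx by (simp only: mult.assoc)
qed

text \<open>Both integrands are nonnegative, so both integrals are \<open>enn2real\<close> of
  nonnegative integrals, and the substitution carries over without a separate proof of
  integrability.\<close>

lemma set_integral_weight_eq_tilt:
  fixes \<alpha> :: "'i \<Rightarrow> real" and \<beta> :: real and N :: nat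
  assumes "finite I" and \<alpha>: "\<And>i. i \<in> I \<Longrightarrow> \<alpha> i > 0" and "\<beta> > 0" and "N > 0"
  shows "(LINT r : (PiE I (\<lambda>_. {0<..})) | (PiM I (\<lambda>_. lborel)).
            exp (- (\<Sum>i\<in>I. (r i)\<^sup>2) - (\<Prod>i\<in>I. \<alpha> i * N) * (\<beta> * N) / (\<Prod>i\<in>I. (r i)\<^sup>2)) *
           (\<Prod>i\<in>I. r i powr (2 * (\<alpha> i * N - \<beta> * N) - 1))) =
         (1 / (2 * sqrt N)) ^ card I * (\<Prod>i\<in>I. (\<alpha> i * N) powr (\<alpha> i * N - \<beta> * N)) *
           exp (- ((\<Sum>i\<in>I. \<alpha> i * N) + \<beta> * N)) *
           (\<integral>x. (\<Prod>i\<in>I. tilt (\<alpha> i) N 0 (x i)) * tilt \<beta> N 0 (- (\<Sum>i\<in>I. x i)) \<partial>PiM I (\<lambda>_. lborel))"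
proof -
  let ?M = "PiM I (\<lambda>_. lborel :: real measure)"
  let ?f = "\<lambda>r. exp (- (\<Sum>i\<in>I. (r i)\<^sup>2) - (\<Prod>i\<in>I. \<alpha> i * N) * (\<beta> * N) / (\<Prod>i\<in>I. (r i)\<^sup>2)) *
           (\<Prod>i\<in>I. r i powr (2 * (\<alpha> i * N - \<beta> * N) - 1))"
  let ?q = "1 / (2 * sqrt N)"
  let ?J = "\<lambda>x i. sqrt (\<alpha> i * N) * ?q * exp (?q * x i)"
  let ?r = "\<lambda>x i. sqrt (\<alpha> i * N) * exp (?q * x i)"
  let ?K = "?q ^ card I * (\<Prod>i\<in>I. (\<alpha> i * N) powr (\<alpha> i * N - \<beta> * N)) *
           exp (- ((\<Sum>i\<in>I. \<alpha> i * N) + \<beta> * N))"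
  let ?T = "\<lambda>x. (\<Prod>i\<in>I. tilt (\<alpha> i) N 0 (x i)) * tilt \<beta> N 0 (- (\<Sum>i\<in>I. x i))"
  have f_nonneg: "?f r \<ge> 0" for r by (intro mult_nonneg_nonneg prod_nonneg) auto
  have [measurable]: "PiE I (\<lambda>_. {0<..}) \<in> sets ?M"
    using assms(1) by (intro sets_PiM_I_finite) auto
  have f_meas [measurable]: "?f \<in> borel_measurable ?M" by measurable
  have "(LINT r : (PiE I (\<lambda>_. {0<..})) | ?M. ?f r) =
      enn2real (\<integral>\<^sup>+r. ennreal (?f r) * indicator (PiE I (\<lambda>_. {0<..})) r \<partial>?M)"
    unfolding set_lebesgue_integral_def
  proof (subst integral_eq_nn_integral)
    show "(\<lambda>r. indicator (PiE I (\<lambda>_. {0<..})) r *\<^sub>R ?f r) \<in> borel_measurable ?M" by measurable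
    show "AE r in ?M. 0 \<le> indicator (PiE I (\<lambda>_. {0<..})) r *\<^sub>R ?f r"
      using f_nonneg by (intro AE_I2 scaleR_nonneg_nonneg) auto
    show "enn2real (\<integral>\<^sup>+r. ennreal (indicator (PiE I (\<lambda>_. {0<..})) r *\<^sub>R ?f r) \<partial>?M) =
      enn2real (\<integral>\<^sup>+r. ennreal (?f r) * indicator (PiE I (\<lambda>_. {0<..})) r \<partial>?M)"
      by (intro arg_cong[where f = enn2real] nn_integral_cong) (simp add: indicator_def)
  qed
  also have "(\<integral>\<^sup>+r. ennreal (?f r) * indicator (PiE I (\<lambda>_. {0<..})) r \<partial>?M) =
      (\<integral>\<^sup>+x. ennreal (?f (\<lambda>i\<in>I. ?r x i)) * (\<Prod>i\<in>I. ennreal (?J x i)) \<partial>?M)"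
    using assms f_meas by (intro nn_integral_PiM_exp_substitution) auto
  also have "\<dots> = (\<integral>\<^sup>+x. ennreal (?K * ?T x) \<partial>?M)"
  proof (intro nn_integral_cong)
    fix x :: "'i \<Rightarrow> real"
    have J: "?J x i \<ge> 0" if "i \<in> I" for i using \<alpha>[OF that] by simp
    have "?f (\<lambda>i\<in>I. ?r x i) = ?f (?r x)"
      by (intro arg_cong2[where f = "(*)"] arg_cong[where f = exp] arg_cong2[where f = "(-)"]
          arg_cong[where f = uminus] arg_cong2[where f = "(/)"] sum.cong prod.cong refl) auto
    then have "ennreal (?f (\<lambda>i\<in>I. ?r x i)) * (\<Prod>i\<in>I. ennreal (?J x i)) =
        ennreal (?f (?r x) * (\<Prod>i\<in>I. ?J x i))"
      using f_nonneg[of "?r x"] J by (simp only: prod_ennreal ennreal_mult prod_nonneg)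
    also have "?f (?r x) * (\<Prod>i\<in>I. ?J x i) = ?K * ?T x"
      by (rule weight_integrand_exp_substitution[OF assms])
    finally show "ennreal (?f (\<lambda>i\<in>I. ?r x i)) * (\<Prod>i\<in>I. ennreal (?J x i)) = ennreal (?K * ?T x)" .
  qed
  also have "enn2real \<dots> = (\<integral>x. ?K * ?T x \<partial>?M)"
  proof (rule integral_eq_nn_integral[symmetric])
    show "(\<lambda>x. ?K * ?T x) \<in> borel_measurable ?M" by measurable
    show "AE x in ?M. 0 \<le> ?K * ?T x"
      by (intro AE_I2 mult_nonneg_nonneg prod_nonneg) (auto simp: tilt_pos less_imp_le)
  qed
  also have "\<dots> = ?K * (\<integral>x. ?T x \<partial>?M)" by simp
  finally show ?thesis .
qed

section \<open>The algebraic equation and the annulus\<close>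

text \<open>Raising the shift from a value where all factors are nonnegative makes every factor
  strictly larger and positive. Allowing zero factors covers \<open>u = 0\<close> when some
  \<open>\<delta> i\<close> vanishes.\<close>

lemma prod_shift_less_iff:
  fixes \<delta> :: "'i \<Rightarrow> real"
  assumes "finite I" "I \<noteq> {}" "\<And>i. i \<in> I \<Longrightarrow> \<delta> i + u \<ge> 0" "\<And>i. i \<in> I \<Longrightarrow> \<delta> i + v \<ge> 0"
  shows "(\<Prod>i\<in>I. \<delta> i + u) < (\<Prod>i\<in>I. \<delta> i + v) \<longleftrightarrow> u < v"
proof -
  have less: "(\<Prod>i\<in>I. \<delta> i + u') < (\<Prod>i\<in>I. \<delta> i + v')"
    if "u' < v'" "\<And>i. i \<in> I \<Longrightarrow> \<delta> i + u' \<ge> 0" for u' v'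
  proof -
    obtain i where i: "i \<in> I" using assms(2) by blast
    show ?thesis
    proof (rule prod_mono_strict[OF i _ assms(1)])
      show "0 < \<delta> j + v'" "0 \<le> \<delta> j + u' \<and> \<delta> j + u' \<le> \<delta> j + v'" if "j \<in> I" for j
        using \<open>\<And>i. i \<in> I \<Longrightarrow> \<delta> i + u' \<ge> 0\<close>[OF that] \<open>u' < v'\<close> by linarith+
    qed (use \<open>u' < v'\<close> in simp)
  qed
  show ?thesis
    using less[of u v] less[of v u] assms(3,4) by (cases u v rule: linorder_cases) auto
qed

text \<open>Intermediate value theorem: at \<open>t = - \<mu>\<close>, with \<open>\<mu>\<close> the
  least \<open>\<delta> i\<close>, the product is 0; at \<open>T - \<mu>\<close> every factor is at
  least \<open>T = max 1 s\<close>, so the product is at least \<open>s\<close>. No factor vanishes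
  at the solution because \<open>s > 0\<close>.\<close>

lemma ex_prod_shift_eq:
  fixes \<delta> :: "'i \<Rightarrow> real"
  assumes "finite I" "I \<noteq> {}" "s > 0"
  obtains t where "\<And>i. i \<in> I \<Longrightarrow> \<delta> i + t > 0" "(\<Prod>i\<in>I. \<delta> i + t) = s"
proof -
  define \<mu> where "\<mu> = Min (\<delta> ` I)"
  have \<mu>: "\<mu> \<le> \<delta> i" if "i \<in> I" for i
    using that assms by (simp add: \<mu>_def)
  have "\<mu> \<in> \<delta> ` I" unfolding \<mu>_def using assms by (intro Min_in) auto
  then have zero: "(\<Prod>i\<in>I. \<delta> i + - \<mu>) = 0" using assms(1) by auto
  define T where "T = max 1 s"
  have "s \<le> T ^ 1" by (simp add: T_def)
  also have "\<dots> \<le> T ^ card I"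
    using assms by (intro power_increasing) (auto simp: T_def Suc_le_eq card_gt_0_iff)
  also have "\<dots> = (\<Prod>i\<in>I. T)" by simp
  also have "\<dots> \<le> (\<Prod>i\<in>I. \<delta> i + (T - \<mu>))"
  proof (rule prod_mono)
    fix i assume "i \<in> I"
    moreover have "T \<ge> 0" by (simp add: T_def)
    ultimately show "0 \<le> T \<and> T \<le> \<delta> i + (T - \<mu>)" using \<mu>[of i] by linarith
  qed
  finally have upper: "s \<le> (\<Prod>i\<in>I. \<delta> i + (T - \<mu>))" .
  have lower: "(\<Prod>i\<in>I. \<delta> i + - \<mu>) \<le> s"
    using assms(3) unfolding zero by simp
  have "\<exists>t. - \<mu> \<le> t \<and> t \<le> T - \<mu> \<and> (\<Prod>i\<in>I. \<delta> i + t) = s"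
    by (rule IVT'[where f = "\<lambda>t. \<Prod>i\<in>I. \<delta> i + t", OF lower upper]) (auto simp: T_def intro!: continuous_intros)
  then obtain t where t: "t \<ge> - \<mu>" "(\<Prod>i\<in>I. \<delta> i + t) = s" by auto
  have "\<delta> i + t > 0" if "i \<in> I" for i
  proof -
    have "\<delta> i + t \<noteq> 0" using t(2) that assms by (metis less_irrefl prod_zero)
    then show ?thesis using \<mu>[OF that] t(1) by linarith
  qed
  with t(2) show ?thesis using that by blast
qed

text \<open>A larger root would enlarge all the positive factors \<open>\<delta> k + t\<close>, and
  the product would exceed the squared modulus.\<close>

lemma largest_root_eq:
  assumes "m \<ge> 1" "z \<noteq> 0" and pos: "\<And>k. k \<in> {1..m} \<Longrightarrow> \<delta> k + t > 0"
    and eq: "(\<Prod>k=1..m. \<delta> k + t) = (cmod z)\<^sup>2"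
  shows "(cmod z)\<^sup>2 * largest_root m \<delta> z = \<delta> m + t"
proof -
  define s where "s = (cmod z)\<^sup>2"
  have s: "s > 0" using assms by (simp add: s_def)
  have shift: "\<delta> k - \<delta> m + s * x = \<delta> k + (s * x - \<delta> m)" for k x by simp
  have "largest_root m \<delta> z = (\<delta> m + t) / s"
    unfolding largest_root_def s_def[symmetric] shift
  proof (rule Greatest_equality)
    show "(\<Prod>k=1..m. \<delta> k + (s * ((\<delta> m + t) / s) - \<delta> m)) - s = 0"
      using s eq by (simp add: s_def)
    fix x assume x: "(\<Prod>k=1..m. \<delta> k + (s * x - \<delta> m)) - s = 0"
    show "x \<le> (\<delta> m + t) / s"
    proof (rule ccontr)
      assume "\<not> ?thesis"
      then have less: "t < s * x - \<delta> m" using s by (simp add: field_simps)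
      then have "(\<Prod>k=1..m. \<delta> k + t) < (\<Prod>k=1..m. \<delta> k + (s * x - \<delta> m))"
        using assms(1) pos by (subst prod_shift_less_iff) (force dest: pos)+
      then show False using x eq by (simp add: s_def)
    qed
  qed
  then show ?thesis using s by (simp add: s_def)
qed

text \<open>The squared inner radius, squared modulus and squared outer radius are the values at 0,
  \<open>t\<close> and 1 of one product that is strictly increasing there. Comparing radii therefore
  means comparing \<open>t\<close> with 0 and 1.\<close>

lemma annulus_indicator_eq:
  fixes m :: nat and \<delta> :: "nat \<Rightarrow> real"
  assumes "m \<ge> 1" and nonneg: "\<And>k. k \<in> {1..m} \<Longrightarrow> \<delta> k \<ge> 0"
    and pos: "\<And>k. k \<in> {1..m} \<Longrightarrow> \<delta> k + t > 0"
    and eq: "(\<Prod>k=1..m. \<delta> k + t) = (cmod z)\<^sup>2"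
  shows "annulus_indicator (sqrt (\<Prod>k=1..m. \<delta> k)) (sqrt (\<Prod>k=1..m. 1 + \<delta> k)) z = unit_interval_weight t"
proof -
  define p where "p u = (\<Prod>k=1..m. \<delta> k + u)" for u
  have iff: "p u < p v \<longleftrightarrow> u < v" if "u \<in> {0, 1, t}" "v \<in> {0, 1, t}" for u v
    unfolding p_def using that assms(1) nonneg pos
    by (intro prod_shift_less_iff) (auto simp: less_imp_le)
  have cm: "cmod z = sqrt (p t)" using eq by (simp add: p_def)
  have iff_eq: "p u = p v \<longleftrightarrow> u = v" if "u \<in> {0, 1, t}" "v \<in> {0, 1, t}" for u v
    using iff[OF that] iff[OF that(2,1)] by force
  have p1: "(\<Prod>k=1..m. 1 + \<delta> k) = p 1" by (simp add: p_def add.commute)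
  have p0: "(\<Prod>k=1..m. \<delta> k) = p 0" by (simp add: p_def)
  \<comment> \<open>For inner radius 0 the value \<open>t = 0\<close> cannot occur, which agrees
    with the convention that there is then no inner boundary circle.\<close>
  have "t > 0" if "\<not> p 0 > 0"
  proof -
    have "p t > 0" unfolding p_def using pos by (intro prod_pos) auto
    with that have "p 0 < p t" by linarith
    then show ?thesis using iff[of 0 t] by simp
  qed
  then show ?thesis
    unfolding annulus_indicator_def unit_interval_weight_def cm p0 p1
    by (auto simp: iff iff_eq)
qed

section \<open>Exact form of the kernel on the diagonal\<close>

lemma weight_nonneg: "(\<And>k. k \<in> {1..m} \<Longrightarrow> a k \<ge> 0) \<Longrightarrow> weight m a z \<ge> 0"
  unfolding weight_def set_lebesgue_integral_def
  by (intro mult_nonneg_nonneg prod_nonneg Bochner_Integration.integral_nonneg)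
     (auto intro!: divide_nonneg_nonneg mult_nonneg_nonneg less_imp_le[OF Gamma_real_pos] prod_nonneg simp: indicator_def add_nonneg_pos)

lemma kernel_diagonal:
  assumes "\<And>k. k \<in> {1..m} \<Longrightarrow> a k \<ge> 0"
  shows "kernel m a N z z = of_real (\<Sum>l<N. weight m a z *
           (\<Prod>k=1..m. Gamma (a k + 1) / Gamma (a k + real l + 1)) * (cmod z)\<^sup>2 ^ l)"
proof -
  have "weight m a (cnj z) = weight m a z"
    by (simp add: weight_def)
  then have "sqrt (weight m a z * weight m a (cnj z)) = weight m a z"
    using weight_nonneg[OF assms, of m] by simp
  then show ?thesis
    unfolding kernel_def complex_norm_square[symmetric]
    by (simp add: sum_distrib_left mult.assoc flip: of_real_power)
qed

text \<open>An identity for each fixed \<open>N\<close>: all Gamma values, powers and exponentials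
  are absorbed into the integrals of \<open>tilt\<close>. Only the factor with
  \<open>tilt_mass\<close> depends on \<open>l\<close>. Here \<open>z\<close> is the rescaled point,
  whose squared modulus is the product of the \<open>c k\<close>.\<close>

lemma weight_times_coeff:
  fixes m N l :: nat and \<delta> :: "nat \<Rightarrow> real" and t :: real and z :: complex
  assumes m: "m \<ge> 1" and N: "N > 0"
    and nonneg: "\<And>k. k \<in> {1..m} \<Longrightarrow> \<delta> k \<ge> 0"
    and pos: "\<And>k. k \<in> {1..m} \<Longrightarrow> \<delta> k + t > 0"
    and eq: "(\<Prod>k=1..m. (\<delta> k + t) * N) = (cmod z)\<^sup>2"
  shows "weight m (\<lambda>k. \<delta> k * N) z *
           (\<Prod>k=1..m. Gamma (\<delta> k * N + 1) / Gamma (\<delta> k * N + real l + 1)) * (cmod z)\<^sup>2 ^ l =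
         sqrt N / (pi * (cmod z)\<^sup>2) *
         (\<integral>x. (\<Prod>k\<in>{1..<m}. tilt (\<delta> k + t) N 0 (x k)) * tilt (\<delta> m + t) N 0 (- (\<Sum>k\<in>{1..<m}. x k))
            \<partial>PiM {1..<m} (\<lambda>_. lborel)) *
         (\<Prod>k=1..m. 1 / tilt_mass (\<delta> k + t) N (real l + 1 - t * N))"
proof -
  define c where "c k = (\<delta> k + t) * N" for k
  define X where "X = (cmod z)\<^sup>2"
  define P where "P = (\<integral>x. (\<Prod>k\<in>{1..<m}. tilt (\<delta> k + t) N 0 (x k)) *
      tilt (\<delta> m + t) N 0 (- (\<Sum>k\<in>{1..<m}. x k)) \<partial>PiM {1..<m} (\<lambda>_. lborel))"
  define G where "G k = Gamma (\<delta> k * N + real l + 1)" for k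
  define G0 where "G0 k = Gamma (\<delta> k * N + 1)" for k
  have ins: "{1..m} = insert m {1..<m}" using m by auto
  have c: "c k > 0" if "k \<in> {1..m}" for k using pos[OF that] N by (simp add: c_def)
  have G: "G k > 0" "G0 k > 0" if "k \<in> {1..m}" for k
    unfolding G_def G0_def using nonneg[OF that] by (auto intro!: Gamma_real_pos add_nonneg_pos)
  have X: "X = (\<Prod>k=1..m. c k)" using eq by (simp add: X_def c_def)
  have Xpos: "X > 0" unfolding X using c by (intro prod_pos) auto
  then have "z \<noteq> 0" by (auto simp: X_def)
  have X': "X = (\<Prod>k\<in>{1..<m}. c k) * c m" unfolding X ins by simp
  \<comment> \<open>The shift \<open>t\<close> cancels in differences, so the exponents of the
    weight are already differences of saddle points.\<close>
  have diff: "\<delta> k * N - \<delta> m * N = c k - c m" for k by (simp add: c_def algebra_simps)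
  let ?K = "\<Prod>k=1..m. c k powr (c k - c m)"
  let ?E = "exp (- (\<Sum>k=1..m. c k))"
  have "(LINT r : (PiE {1..<m} (\<lambda>_. {0<..})) | (PiM {1..<m} (\<lambda>_. lborel)).
        exp (- (\<Sum>k\<in>{1..<m}. (r k)\<^sup>2) - X / (\<Prod>k\<in>{1..<m}. (r k)\<^sup>2)) *
        (\<Prod>k\<in>{1..<m}. r k powr (2 * (c k - c m) - 1))) =
      (1 / (2 * sqrt N)) ^ (m - 1) * (\<Prod>k\<in>{1..<m}. c k powr (c k - c m)) *
           exp (- ((\<Sum>k\<in>{1..<m}. c k) + c m)) * P"
    unfolding X' P_def c_def using m N pos
    by (subst set_integral_weight_eq_tilt) auto
  \<comment> \<open>The factor for \<open>k = m\<close> that is added has exponent 0.\<close>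
  also have "(\<Prod>k\<in>{1..<m}. c k powr (c k - c m)) = ?K"
    unfolding ins using c[of m] m by simp
  also have "(\<Sum>k\<in>{1..<m}. c k) + c m = (\<Sum>k=1..m. c k)"
    unfolding ins by simp
  finally have integral: "(LINT r : (PiE {1..<m} (\<lambda>_. {0<..})) | (PiM {1..<m} (\<lambda>_. lborel)).
        exp (- (\<Sum>k\<in>{1..<m}. (r k)\<^sup>2) - X / (\<Prod>k\<in>{1..<m}. (r k)\<^sup>2)) *
        (\<Prod>k\<in>{1..<m}. r k powr (2 * (c k - c m) - 1))) =
      (1 / (2 * sqrt N)) ^ (m - 1) * ?K * ?E * P" .
  have absz: "cmod z powr (2 * (\<delta> m * N)) = X powr (\<delta> m * N)"
    using \<open>z \<noteq> 0\<close> by (simp add: X_def powr_powr flip: powr_numeral)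
  have "weight m (\<lambda>k. \<delta> k * N) z = X powr (\<delta> m * N) * (2 ^ (m - 1) / pi) * (\<Prod>k=1..m. 1 / G0 k) *
      ((1 / (2 * sqrt N)) ^ (m - 1) * ?K * ?E * P)"
    unfolding weight_def X_def[symmetric] diff integral absz G0_def ..
  also have "\<dots> = (1 / pi) * (X powr (\<delta> m * N) * ?K) * (\<Prod>k=1..m. 1 / G0 k) *
      ((2 ^ (m - 1) * (1 / (2 * sqrt N)) ^ (m - 1)) * ?E * P)"
    by simp
  also have "2 ^ (m - 1) * (1 / (2 * sqrt N)) ^ (m - 1) = (1 / sqrt N) ^ (m - 1)"
    by (simp flip: power_mult_distrib)
  finally have w: "weight m (\<lambda>k. \<delta> k * N) z = (1 / pi) * (X powr (\<delta> m * N) * ?K) * (\<Prod>k=1..m. 1 / G0 k) *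
      ((1 / sqrt N) ^ (m - 1) * ?E * P)" .
  \<comment> \<open>Distributing \<open>X\<close> over the \<open>c k\<close> collects the exponents
    that belong to the Gamma values in the denominators. This takes one more factor \<open>X\<close>
    than the summand has, hence the prefactor \<open>1 / X\<close>.\<close>
  have "X powr (\<delta> m * N) * ?K * X ^ l * X =
      (\<Prod>k=1..m. c k powr (\<delta> m * N) * c k powr (c k - c m) * c k ^ l * c k)"
    using c unfolding X by (simp add: prod.distrib prod_powr_distrib prod_power_distrib less_imp_le)
  also have "\<dots> = (\<Prod>k=1..m. c k powr (\<delta> k * N + real l + 1))"
  proof (intro prod.cong refl)
    fix k assume k: "k \<in> {1..m}"
    have "c k powr (\<delta> m * N) * c k powr (c k - c m) * c k ^ l * c k =
        c k powr (\<delta> m * N) * c k powr (c k - c m) * c k powr (real l) * c k powr 1"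
      using c[OF k] by (simp add: powr_realpow)
    also have "\<dots> = c k powr (\<delta> m * N + (c k - c m) + real l + 1)"
      by (simp only: powr_add)
    also have "\<delta> m * N + (c k - c m) + real l + 1 = \<delta> k * N + real l + 1"
      using diff[of k] by simp
    finally show "c k powr (\<delta> m * N) * c k powr (c k - c m) * c k ^ l * c k =
        c k powr (\<delta> k * N + real l + 1)" .
  qed
  finally have powers: "X powr (\<delta> m * N) * ?K * X ^ l = (\<Prod>k=1..m. c k powr (\<delta> k * N + real l + 1)) / X"
    using Xpos by (simp add: field_simps)
  have mass: "1 / tilt_mass (\<delta> k + t) N (real l + 1 - t * N) =
      (1 / sqrt N) * exp (- c k) * (1 / G k) * c k powr (\<delta> k * N + real l + 1)" if k: "k \<in> {1..m}" for k
  proof -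
    \<comment> \<open>The second parameter \<open>l + 1 - t * N\<close> is the one for which
      \<open>t\<close> drops out of the shape.\<close>
    have arg: "(\<delta> k + t) * N + (real l + 1 - t * N) = \<delta> k * N + real l + 1"
      by (simp add: algebra_simps)
    have "tilt_mass (\<delta> k + t) N (real l + 1 - t * N) =
        sqrt N * exp (c k) * G k / c k powr (\<delta> k * N + real l + 1)"
      using has_bochner_integral_tilt[of "\<delta> k + t" N "real l + 1 - t * N"] pos[OF k] nonneg[OF k] N
      unfolding arg by (simp add: has_bochner_integral_iff tilt_mass_def G_def c_def add_nonneg_pos)
    then show ?thesis by (simp add: exp_minus field_simps)
  qed
  have masses: "(\<Prod>k=1..m. 1 / tilt_mass (\<delta> k + t) N (real l + 1 - t * N)) =
      (1 / sqrt N) ^ m * ?E * (\<Prod>k=1..m. 1 / G k) * (\<Prod>k=1..m. c k powr (\<delta> k * N + real l + 1))"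
    using mass by (simp add: prod.distrib prod_dividef power_one_over flip: sum_negf exp_sum)
  have gam: "(\<Prod>k=1..m. 1 / G0 k) * (\<Prod>k=1..m. G0 k / G k) = (\<Prod>k=1..m. 1 / G k)"
    unfolding prod.distrib[symmetric]
  proof (rule prod.cong[OF refl])
    fix k assume "k \<in> {1..m}"
    from G[OF this] show "1 / G0 k * (G0 k / G k) = 1 / G k" by simp
  qed
  \<comment> \<open>The weight supplies \<open>m - 1\<close> factors \<open>1 / sqrt N\<close> and
    the masses absorb \<open>m\<close>, so one factor \<open>sqrt N\<close> is left over.\<close>
  have sq: "(1 / sqrt N) ^ (m - 1) = sqrt N * (1 / sqrt N) ^ m"
    using m N by (cases m) auto
  have "weight m (\<lambda>k. \<delta> k * N) z * (\<Prod>k=1..m. G0 k / G k) * X ^ l =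
      (1 / pi) * (X powr (\<delta> m * N) * ?K * X ^ l) * ((\<Prod>k=1..m. 1 / G0 k) * (\<Prod>k=1..m. G0 k / G k)) *
      ((1 / sqrt N) ^ (m - 1) * ?E * P)"
    unfolding w by (simp only: mult_ac)
  also have "\<dots> = sqrt N / (pi * X) * P * ((1 / sqrt N) ^ m * ?E * (\<Prod>k=1..m. 1 / G k) *
      (\<Prod>k=1..m. c k powr (\<delta> k * N + real l + 1)))"
    unfolding powers gam sq by simp
  also have "\<dots> = sqrt N / (pi * X) * P *
      (\<Prod>k=1..m. 1 / tilt_mass (\<delta> k + t) N (real l + 1 - t * N))"
    unfolding masses ..
  finally show ?thesis unfolding P_def G_def G0_def X_def .
qed

section \<open>The limit of the sum and of the density\<close>

lemma has_bochner_integral_gaussian: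
  fixes b :: real
  assumes "b > 0"
  shows "has_bochner_integral lborel (\<lambda>y. exp (- b * y\<^sup>2 / 2)) (sqrt (2 * pi / b))"
proof -
  have "has_bochner_integral lborel (normal_density 0 (1 / sqrt b)) 1"
    using assms by (simp add: has_bochner_integral_iff)
  from has_bochner_integral_mult_right[OF this, of "sqrt (2 * pi / b)"] show ?thesis
    unfolding gaussian_eq_normal_density[OF assms] by simp
qed

text \<open>Each mass tends to a multiple of \<open>exp (y\<^sup>2 / (2 * \<alpha> i))\<close>, so
  the product of the reciprocals tends to a Gaussian in \<open>y\<close> whose precision is the sum
  of the \<open>1 / \<alpha> i\<close>. The lower bound on the masses supplies the
  domination.\<close>

lemma scaled_sum_tilt_mass_tendsto:
  fixes \<alpha> :: "'i \<Rightarrow> real" and t :: real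
  assumes I: "finite I" "I \<noteq> {}" and \<alpha>: "\<And>i. i \<in> I \<Longrightarrow> \<alpha> i > 0" "\<And>i. i \<in> I \<Longrightarrow> \<alpha> i \<ge> t"
  shows "(\<lambda>N. (\<Sum>l<N. \<Prod>i\<in>I. 1 / tilt_mass (\<alpha> i) N (real l + 1 - t * N)) / sqrt (real N)) \<longlonglongrightarrow>
    unit_interval_weight t *
      ((\<Prod>i\<in>I. 1 / sqrt (2 * pi / \<alpha> i)) * sqrt (2 * pi / (\<Sum>i\<in>I. 1 / \<alpha> i)))"
proof -
  let ?B = "\<Sum>i\<in>I. 1 / \<alpha> i"
  let ?g = "\<lambda>y. \<Prod>i\<in>I. 1 / (sqrt (2 * pi / \<alpha> i) * exp (y\<^sup>2 / (2 * \<alpha> i)))"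
  have B: "?B > 0" using I \<alpha> by (intro sum_pos) auto
  have g: "?g = (\<lambda>y. (\<Prod>i\<in>I. 1 / sqrt (2 * pi / \<alpha> i)) * exp (- ?B * y\<^sup>2 / 2))"
  proof
    fix y
    have "?g y = (\<Prod>i\<in>I. 1 / sqrt (2 * pi / \<alpha> i) * exp (- (y\<^sup>2 / (2 * \<alpha> i))))"
      by (intro prod.cong refl) (simp add: exp_minus field_simps)
    also have "\<dots> = (\<Prod>i\<in>I. 1 / sqrt (2 * pi / \<alpha> i)) * exp (\<Sum>i\<in>I. - (y\<^sup>2 / (2 * \<alpha> i)))"
      unfolding prod.distrib exp_sum[OF I(1)] ..
    also have "(\<Sum>i\<in>I. - (y\<^sup>2 / (2 * \<alpha> i))) = (\<Sum>i\<in>I. 1 / \<alpha> i * (- y\<^sup>2 / 2))"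
      by (intro sum.cong refl) simp
    also have "\<dots> = - ?B * y\<^sup>2 / 2"
      unfolding sum_distrib_right[symmetric] by simp
    finally show "?g y = (\<Prod>i\<in>I. 1 / sqrt (2 * pi / \<alpha> i)) * exp (- ?B * y\<^sup>2 / 2)" .
  qed
  have int: "has_bochner_integral lborel ?g ((\<Prod>i\<in>I. 1 / sqrt (2 * pi / \<alpha> i)) * sqrt (2 * pi / ?B))"
    unfolding g by (intro has_bochner_integral_mult_right has_bochner_integral_gaussian B)
  have "(\<lambda>N. (\<Sum>l<N. \<Prod>i\<in>I. 1 / tilt_mass (\<alpha> i) N (real l + 1 - t * N)) / sqrt (real N)) \<longlonglongrightarrow>
    unit_interval_weight t * (\<integral>y. ?g y \<partial>lborel)"
  proof (rule scaled_sum_tendsto)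
    show "(\<lambda>N. \<Prod>i\<in>I. 1 / tilt_mass (\<alpha> i) N (\<beta> N)) \<longlonglongrightarrow> ?g y"
      if "(\<lambda>N. \<beta> N / sqrt (real N)) \<longlonglongrightarrow> y" for \<beta> y
      by (intro tendsto_prod tendsto_divide tendsto_const tilt_mass_tendsto) (use that \<alpha>(1) in force)+
    show "eventually (\<lambda>N. \<forall>l::nat. \<bar>\<Prod>i\<in>I. 1 / tilt_mass (\<alpha> i) N (real l + 1 - t * N)\<bar> \<le>
        (\<Prod>i\<in>I. exp (4 * \<alpha> i)) * exp (- \<bar>real l + 1 - t * N\<bar> / sqrt (real N))) sequentially"
      using eventually_ge_at_top[of 4]
    proof (eventually_elim, intro allI)
      fix N l :: nat assume N: "N \<ge> 4"
      let ?\<beta> = "real l + 1 - t * N"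
      let ?e = "exp (- \<bar>?\<beta>\<bar> / sqrt (real N))"
      have le: "0 \<le> 1 / tilt_mass (\<alpha> i) N ?\<beta> \<and> 1 / tilt_mass (\<alpha> i) N ?\<beta> \<le> exp (4 * \<alpha> i) * ?e" if i: "i \<in> I" for i
      proof -
        \<comment> \<open>Here \<open>\<alpha> i \<ge> t\<close> keeps the shape
          \<open>(\<alpha> i - t) * N + l + 1\<close> positive for every \<open>l\<close>.\<close>
        have "t * N \<le> \<alpha> i * N" using \<alpha>(2)[OF i] by (intro mult_right_mono) auto
        then have "\<alpha> i * N + ?\<beta> > 0" by linarith
        then have ge: "tilt_mass (\<alpha> i) N ?\<beta> \<ge> exp (- 4 * \<alpha> i) * exp (\<bar>?\<beta>\<bar> / sqrt N)"
          using \<alpha>(1)[OF i] N by (intro tilt_mass_ge) auto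
        have "0 < exp (- 4 * \<alpha> i) * exp (\<bar>?\<beta>\<bar> / sqrt N)" by simp
        with ge have "tilt_mass (\<alpha> i) N ?\<beta> > 0" by linarith
        moreover have "1 / tilt_mass (\<alpha> i) N ?\<beta> \<le> 1 / (exp (- 4 * \<alpha> i) * exp (\<bar>?\<beta>\<bar> / sqrt N))"
          using ge by (intro divide_left_mono) (auto intro!: mult_pos_pos calculation)
        moreover have "1 / (exp (- 4 * \<alpha> i) * exp (\<bar>?\<beta>\<bar> / sqrt N)) = exp (4 * \<alpha> i) * ?e"
          by (simp add: exp_minus field_simps)
        ultimately show ?thesis by simp
      qed
      have "\<bar>\<Prod>i\<in>I. 1 / tilt_mass (\<alpha> i) N ?\<beta>\<bar> = (\<Prod>i\<in>I. 1 / tilt_mass (\<alpha> i) N ?\<beta>)"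
        using le by (intro abs_of_nonneg prod_nonneg) auto
      also have "\<dots> \<le> (\<Prod>i\<in>I. exp (4 * \<alpha> i) * ?e)"
        using le by (intro prod_mono) auto
      also have "\<dots> = (\<Prod>i\<in>I. exp (4 * \<alpha> i)) * ?e ^ card I"
        by (simp add: prod.distrib)
      \<comment> \<open>One decay factor suffices: the base is at most 1 and \<open>I\<close> is
        nonempty.\<close>
      also have "?e ^ card I \<le> ?e ^ 1"
        using I by (intro power_decreasing) (auto simp: Suc_le_eq card_gt_0_iff)
      finally show "\<bar>\<Prod>i\<in>I. 1 / tilt_mass (\<alpha> i) N ?\<beta>\<bar> \<le> (\<Prod>i\<in>I. exp (4 * \<alpha> i)) * ?e"
        by (simp add: prod_nonneg mult_left_mono)
    qed
  qed (use int in \<open>auto simp: has_bochner_integral_iff\<close>)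
  then show ?thesis using int by (simp add: has_bochner_integral_iff)
qed

theorem theorem1p2:
  fixes m :: nat and \<delta> :: "nat \<Rightarrow> real" and z :: complex
  assumes "m \<ge> 1"
    and "\<And>k. k \<in> {1..m} \<Longrightarrow> \<delta> k \<ge> 0"
    and "z \<noteq> 0"
  shows "(\<lambda>N. of_nat N ^ (m - 1) *
             correlation m (\<lambda>k. \<delta> k * real N) N
               (vec (of_real (real N powr (real m / 2)) * z) :: complex ^ 1))
         \<longlonglongrightarrow> complex_of_real
           (1 / (pi * (cmod z)\<^sup>2) *
            (1 / (\<Sum>k=1..m. 1 / (\<delta> k - \<delta> m + (cmod z)\<^sup>2 * largest_root m \<delta> z))) *
            annulus_indicator (sqrt (\<Prod>k=1..m. \<delta> k)) (sqrt (\<Prod>k=1..m. 1 + \<delta> k)) z)"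
proof -
  define s where "s = (cmod z)\<^sup>2"
  have s: "s > 0" using assms by (simp add: s_def)
  obtain t where t: "\<And>k. k \<in> {1..m} \<Longrightarrow> \<delta> k + t > 0" "(\<Prod>k=1..m. \<delta> k + t) = s"
    using ex_prod_shift_eq[of "{1..m}" s \<delta>] s assms(1) by auto
  have root: "\<delta> k - \<delta> m + s * largest_root m \<delta> z = \<delta> k + t" for k
    using largest_root_eq[of m z \<delta> t] assms t by (simp add: s_def)
  have annulus: "annulus_indicator (sqrt (\<Prod>k=1..m. \<delta> k)) (sqrt (\<Prod>k=1..m. 1 + \<delta> k)) z = unit_interval_weight t"
    using annulus_indicator_eq[of m \<delta> t z] assms t by (simp add: s_def)
  let ?I = "{1..<m}"
  have ins: "{1..m} = insert m ?I" using assms(1) by auto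
  let ?B = "\<Sum>k=1..m. 1 / (\<delta> k + t)"
  have B: "?B > 0" using t(1) assms(1) by (intro sum_pos) auto
  define P where "P N = (\<integral>x. (\<Prod>k\<in>?I. tilt (\<delta> k + t) N 0 (x k)) *
      tilt (\<delta> m + t) N 0 (- (\<Sum>k\<in>?I. x k)) \<partial>PiM ?I (\<lambda>_. lborel))" for N
  define S where "S N = (\<Sum>l<N. \<Prod>k=1..m. 1 / tilt_mass (\<delta> k + t) N (real l + 1 - t * N)) / sqrt (real N)"
    for N :: nat
  have exact: "of_nat N ^ (m - 1) * correlation m (\<lambda>k. \<delta> k * real N) N
       (vec (of_real (real N powr (real m / 2)) * z) :: complex ^ 1) =
     complex_of_real (1 / (pi * s) * (P N * S N))" if N: "N > 0" for N
  proof -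
    let ?z = "of_real (real N powr (real m / 2)) * z"
    \<comment> \<open>The scaling by \<open>N powr (m / 2)\<close> multiplies the squared modulus by
      \<open>N ^ m\<close>, one factor \<open>N\<close> for each
      \<open>\<delta> k + t\<close>.\<close>
    have "(real N powr (real m / 2))\<^sup>2 = real N ^ m"
      using N by (simp add: powr_realpow powr_powr flip: powr_numeral)
    then have cz: "(cmod ?z)\<^sup>2 = real N ^ m * s"
      using N by (simp add: norm_mult power_mult_distrib s_def)
    also have "\<dots> = (\<Prod>k=1..m. (\<delta> k + t) * N)"
      using t(2) by (simp add: prod.distrib)
    finally have eq: "(\<Prod>k=1..m. (\<delta> k + t) * N) = (cmod ?z)\<^sup>2" ..
    have "correlation m (\<lambda>k. \<delta> k * real N) N (vec ?z :: complex ^ 1) =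
        of_real (\<Sum>l<N. sqrt N / (pi * (cmod ?z)\<^sup>2) * P N *
         (\<Prod>k=1..m. 1 / tilt_mass (\<delta> k + t) N (real l + 1 - t * N)))"
    proof -
      have nonneg: "\<delta> k * real N \<ge> 0" if "k \<in> {1..m}" for k
        using assms(2)[OF that] by simp
      show ?thesis
        unfolding correlation_1 P_def
        by (subst kernel_diagonal[OF nonneg], assumption)
           (intro arg_cong[where f = of_real] sum.cong refl weight_times_coeff[OF assms(1) N assms(2) t(1) eq])
    qed
    also have "\<dots> = of_real (sqrt N / (pi * (cmod ?z)\<^sup>2) * P N * (S N * sqrt N))"
      using N unfolding S_def by (simp add: sum_distrib_left)
    finally have "of_nat N ^ (m - 1) * correlation m (\<lambda>k. \<delta> k * real N) N (vec ?z :: complex ^ 1) =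
        of_real (real N ^ (m - 1) * (sqrt N / (pi * (real N ^ m * s)) * P N * (S N * sqrt N)))"
      unfolding cz by simp
    also have "real N ^ (m - 1) * (sqrt N / (pi * (real N ^ m * s)) * P N * (S N * sqrt N)) =
        (real N ^ (m - 1) * (sqrt N * sqrt N) / real N ^ m) * (1 / (pi * s) * (P N * S N))"
    proof -
      have "a * (r / (pi * (b * s)) * p * (q * r)) = (a * (r * r) / b) * (1 / (pi * s) * (p * q))"
        for a b p q r :: real
        by (simp add: divide_inverse mult_ac)
      then show ?thesis .
    qed
    \<comment> \<open>One \<open>sqrt N\<close> is the prefactor of each summand, the other comes
      from the normalization of \<open>S\<close>; with the factor \<open>N ^ (m - 1)\<close> they
      cancel \<open>N ^ m\<close> from the squared modulus.\<close>
    also have "real N ^ (m - 1) * (sqrt N * sqrt N) / real N ^ m = 1"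
      using N assms(1) by (cases m) auto
    finally show ?thesis by simp
  qed
  have "P \<longlonglongrightarrow> (\<Prod>k\<in>?I. sqrt (2 * pi / (\<delta> k + t))) * sqrt (2 * pi / (\<delta> m + t)) /
      sqrt (2 * pi * (1 / (\<delta> m + t) + (\<Sum>k\<in>?I. 1 / (\<delta> k + t))))"
    unfolding P_def using t(1) assms(1) by (intro integral_PiM_tilt_tendsto) auto
  then have P: "P \<longlonglongrightarrow> (\<Prod>k=1..m. sqrt (2 * pi / (\<delta> k + t))) / sqrt (2 * pi * ?B)"
    unfolding ins by (simp add: mult.commute)
  have "S \<longlonglongrightarrow> unit_interval_weight t * ((\<Prod>k=1..m. 1 / sqrt (2 * pi / (\<delta> k + t))) * sqrt (2 * pi / ?B))"
    unfolding S_def using t(1) assms(1,2) by (intro scaled_sum_tilt_mass_tendsto) auto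
  with P have "(\<lambda>N. 1 / (pi * s) * (P N * S N)) \<longlonglongrightarrow> 1 / (pi * s) *
      ((\<Prod>k=1..m. sqrt (2 * pi / (\<delta> k + t))) / sqrt (2 * pi * ?B) *
       (unit_interval_weight t * ((\<Prod>k=1..m. 1 / sqrt (2 * pi / (\<delta> k + t))) * sqrt (2 * pi / ?B))))"
    by (intro tendsto_intros)
  also have "1 / (pi * s) *
      ((\<Prod>k=1..m. sqrt (2 * pi / (\<delta> k + t))) / sqrt (2 * pi * ?B) *
       (unit_interval_weight t * ((\<Prod>k=1..m. 1 / sqrt (2 * pi / (\<delta> k + t))) * sqrt (2 * pi / ?B)))) =
      1 / (pi * s) * (1 / ?B) * unit_interval_weight t"
  proof -
    have "(\<Prod>k=1..m. sqrt (2 * pi / (\<delta> k + t))) \<noteq> 0"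
      using t(1) by (force simp: prod_zero_iff)
    then have 1: "(\<Prod>k=1..m. sqrt (2 * pi / (\<delta> k + t))) * (\<Prod>k=1..m. 1 / sqrt (2 * pi / (\<delta> k + t))) = 1"
      by (simp only: prod_dividef prod.neutral_const) simp
    \<comment> \<open>The Gaussian value of \<open>P\<close> and the Gaussian sum combine to the
      reciprocal of \<open>?B\<close>, the sum in the claimed density.\<close>
    have 2: "sqrt (2 * pi / ?B) / sqrt (2 * pi * ?B) = 1 / ?B"
      using B by (simp add: real_sqrt_divide real_sqrt_mult)
    have rearr: "1 / (pi * s) * (p / r * (u * (q * v))) = 1 / (pi * s) * (p * q * (v / r)) * u"
      for p q r u v :: real by simp
    show ?thesis unfolding rearr 1 2 by simp
  qed
  finally have "(\<lambda>N. complex_of_real (1 / (pi * s) * (P N * S N))) \<longlonglongrightarrow>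
      complex_of_real (1 / (pi * s) * (1 / ?B) * unit_interval_weight t)"
    by (intro tendsto_of_real)
  moreover have "eventually (\<lambda>N. complex_of_real (1 / (pi * s) * (P N * S N)) =
      of_nat N ^ (m - 1) * correlation m (\<lambda>k. \<delta> k * real N) N
       (vec (of_real (real N powr (real m / 2)) * z) :: complex ^ 1)) sequentially"
    using eventually_gt_at_top[of 0] by eventually_elim (simp only: exact)
  ultimately show ?thesis
    unfolding s_def[symmetric] root annulus by (rule Lim_transform_eventually)
qed

end
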